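(* Let $d\ge2$, $T\ge1$, $t\in\{1,\dots,T\}$, $x_1,\dots,x_{T}\in\mathbb{R}^d_+\setminus\{0\}$, $\lambda\ge1$ and $\mu>0.1$. Let $\bar\phi_t$ be an optimal solution of the problem $$\min\Big\{\bar F_{t-1}[\phi]\ :\ \hat w\in\mathrm{ri}(\Delta_d),\ \mathbb{E}_{w\sim\phi}[w]=\hat w,\ \phi\in\mathsf{Supp}(\mathcal{E}_{t-1,1/4}(\hat w))\Big\},$$ let $w_t=\operatorname{argmin}_{w\in\Delta_d}P_{t-1}(w)$, let $\boldsymbol\Sigma_t=\frac1{16}\big(A^\top\nabla^2L_{t-1}(w_t)A\big)^{-1}$, and let $g_t^{\mathsf{trc}}$ be the truncation of the Gaussian distribution $\mathcal N(w_t,A\boldsymbol\Sigma_tA^\top)$ (supported on $\mathbb{A}_d$) to the ellipsoid $\mathcal{E}_{t-1,1/2}(w_t)$, i.e. its density restricted to that ellipsoid and renormalized. Then $$F_{t-1}[g_t^{\mathsf{trc}}]\le\bar F_{t-1}[\bar\phi_t]+0.5\,\mu(d-1)\log(350\,d)+0.01\,\mu.$$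
   Context: $\Delta_d=\{w\in\mathbb{R}^d_+:\sum_i w[i]=1\}$ is the standard simplex, $\mathrm{ri}(\Delta_d)$ its relative interior, and $\mathbb{A}_d=\{w\in\mathbb{R}^d:\sum_iw[i]=1\}$. $A\in\mathbb{R}^{d\times(d-1)}$ is the matrix whose first $d-1$ rows form $I_{d-1}$ and whose last row is $-(1,\dots,1)$. For $w\in\mathbb{R}^d_{++}$ (positive orthant) let $L_{t-1}(w)=\sum_{\tau=1}^{t-1}-\log(x_\tau^\top w)-\lambda\sum_{i=1}^d\log(w[i])$, $V_{t-1}(w)=\frac12\log\det(A^\top\nabla^2L_{t-1}(w)A)$, and $P_{t-1}(w)=L_{t-1}(w)+\mu V_{t-1}(w)$; all are $+\infty$ outside $\mathbb{R}^d_{++}$. The minimizer of $P_{t-1}$ over $\Delta_d$ exists and is unique. For $\hat w\in\mathrm{ri}(\Delta_d)$ and $r>0$, the Dikin ellipsoid is $$\mathcal{E}_{t-1,r}(\hat w)=\{w\in\mathbb{A}_d:\ (w-\hat w)^\top\nabla^2L_{t-1}(\hat w)(w-\hat w)<r^2\}.$$ For $S\subset\mathbb{A}_d$, $\mathsf{Supp}(S)$ is the set of probability densities (with respect to the $(d-1)$-dimensional Lebesgue measure on $\mathbb{A}_d$) supported on $S$. $\mathrm{Ent}[\phi]=\mathbb{E}_{w\sim\phi}[-\log\phi(w)]$ is the differential entropy and $\mathrm{Cov}[\phi]$ the $d\times d$ covariance matrix. Define $$F_{t-1}[\phi]=\mathbb{E}_{w\sim\phi}[L_{t-1}(w)]-\mu\,\mathrm{Ent}[\phi],$$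 and, for $\phi$ with mean $\hat w=\mathbb{E}_{w\sim\phi}[w]\in\mathrm{ri}(\Delta_d)$, $$\bar F_{t-1}[\phi]=L_{t-1}(\hat w)+\tfrac45\mathrm{tr}\big(\nabla^2L_{t-1}(\hat w)\,\mathrm{Cov}[\phi]\big)-\mu\,\mathrm{Ent}[\phi].$$ *)

theory Defs
  imports "HOL-Probability.Probability"
begin

section \<open>Dimension convention\<close>

text \<open>
  The ambient space is \<open>real ^ 'm option\<close> for an arbitrary finite (nonempty) type \<open>'m\<close>, so that
  \<open>d = CARD('m option) = CARD('m) + 1\<close> ranges over all integers \<open>d \<ge> 2\<close>.
  The indices \<open>Some i\<close> are the first \<open>d - 1\<close> coordinates, and \<open>None\<close> is the last one.
\<close>

definition Amat :: "real ^ 'm ^ ('m::finite option)" where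
  "Amat = (\<chi> i j. case i of Some k \<Rightarrow> (if k = j then 1 else 0) | None \<Rightarrow> - 1)"

definition pos_orthant :: "(real ^ 'n::finite) set" where
  "pos_orthant = {w. \<forall>i. 0 < w $ i}"

definition std_simplex :: "(real ^ 'n::finite) set" where
  "std_simplex = {w. (\<forall>i. 0 \<le> w $ i) \<and> (\<Sum>i\<in>UNIV. w $ i) = 1}"

definition aff_plane :: "(real ^ 'n::finite) set" where
  "aff_plane = {w. (\<Sum>i\<in>UNIV. w $ i) = 1}"

section \<open>The functions L, V, P\<close>

definition partial_deriv :: "'n \<Rightarrow> (real ^ 'n::finite \<Rightarrow> real) \<Rightarrow> real ^ 'n \<Rightarrow> real" where
  "partial_deriv i f w = deriv (\<lambda>s. f (w + s *\<^sub>R axis i 1)) 0"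

definition hessian :: "(real ^ 'n::finite \<Rightarrow> real) \<Rightarrow> real ^ 'n \<Rightarrow> real ^ 'n ^ 'n" where
  "hessian f w = (\<chi> i j. partial_deriv i (partial_deriv j f) w)"

text \<open>
  In all names below, the argument \<open>s\<close> is the subscript \<open>t - 1\<close>.
  The functions with suffix \<open>_fin\<close> are the real-valued formulas, meaningful on the positive orthant
  only; since that set is open, the Hessian at its points does not depend on the values elsewhere.
  The extended-real versions are \<open>\<infinity>\<close> outside the positive orthant.
\<close>

definition L_fin :: "real \<Rightarrow> (nat \<Rightarrow> real ^ 'n::finite) \<Rightarrow> nat \<Rightarrow> real ^ 'n \<Rightarrow> real" where
  "L_fin lam x s w = (\<Sum>\<tau>=1..s. - ln (x \<tau> \<bullet> w)) - lam * (\<Sum>i\<in>UNIV. ln (w $ i))"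

definition L_hess :: "real \<Rightarrow> (nat \<Rightarrow> real ^ 'n::finite) \<Rightarrow> nat \<Rightarrow> real ^ 'n \<Rightarrow> real ^ 'n ^ 'n" where
  "L_hess lam x s w = hessian (L_fin lam x s) w"

definition red_hess ::
  "real \<Rightarrow> (nat \<Rightarrow> real ^ ('m::finite option)) \<Rightarrow> nat \<Rightarrow> real ^ ('m option) \<Rightarrow> real ^ 'm ^ 'm" where
  "red_hess lam x s w = transpose Amat ** L_hess lam x s w ** Amat"

definition V_fin ::
  "real \<Rightarrow> (nat \<Rightarrow> real ^ ('m::finite option)) \<Rightarrow> nat \<Rightarrow> real ^ ('m option) \<Rightarrow> real" where
  "V_fin lam x s w = 1 / 2 * ln (det (red_hess lam x s w))"

definition L_fun :: "real \<Rightarrow> (nat \<Rightarrow> real ^ 'n::finite) \<Rightarrow> nat \<Rightarrow> real ^ 'n \<Rightarrow> ereal" where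
  "L_fun lam x s w = (if w \<in> pos_orthant then ereal (L_fin lam x s w) else \<infinity>)"

definition V_fun ::
  "real \<Rightarrow> (nat \<Rightarrow> real ^ ('m::finite option)) \<Rightarrow> nat \<Rightarrow> real ^ ('m option) \<Rightarrow> ereal" where
  "V_fun lam x s w = (if w \<in> pos_orthant then ereal (V_fin lam x s w) else \<infinity>)"

definition P_fun ::
  "real \<Rightarrow> real \<Rightarrow> (nat \<Rightarrow> real ^ ('m::finite option)) \<Rightarrow> nat \<Rightarrow> real ^ ('m option) \<Rightarrow> ereal" where
  "P_fun lam \<mu> x s w = L_fun lam x s w + ereal \<mu> * V_fun lam x s w"

definition dikin ::
  "real \<Rightarrow> (nat \<Rightarrow> real ^ 'n::finite) \<Rightarrow> nat \<Rightarrow> real \<Rightarrow> real ^ 'n \<Rightarrow> (real ^ 'n) set" where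
  "dikin lam x s r v = {w \<in> aff_plane. (w - v) \<bullet> (L_hess lam x s v *v (w - v)) < r\<^sup>2}"

section \<open>Densities on the hyperplane\<close>

text \<open>
  The \<open>(d - 1)\<close>-dimensional Lebesgue measure on the affine hyperplane, as a measure on the ambient
  space: the image of Lebesgue measure under the parametrization \<open>u \<mapsto> A u + e\<^sub>d\<close>, multiplied by the
  area factor \<open>sqrt (det (A\<^sup>T A)) = sqrt d\<close>.
\<close>

definition plane_lborel :: "(real ^ ('m::finite option)) measure" where
  "plane_lborel =
     distr (density lborel (\<lambda>_. ennreal (sqrt (det (transpose Amat ** (Amat :: real ^ 'm ^ ('m option)))))))
       borel (\<lambda>u :: real ^ 'm. Amat *v u + axis None 1)"

definition law :: "(real ^ ('m::finite option) \<Rightarrow> real) \<Rightarrow> (real ^ ('m option)) measure" where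
  "law \<phi> = density plane_lborel (\<lambda>w. ennreal (\<phi> w))"

definition prob_density :: "(real ^ ('m::finite option) \<Rightarrow> real) \<Rightarrow> bool" where
  "prob_density \<phi> \<longleftrightarrow> \<phi> \<in> borel_measurable borel \<and> (\<forall>w. 0 \<le> \<phi> w) \<and> prob_space (law \<phi>)"

definition Supp :: "(real ^ ('m::finite option)) set \<Rightarrow> (real ^ ('m option) \<Rightarrow> real) set" where
  "Supp S = {\<phi>. prob_density \<phi> \<and> (AE w in plane_lborel. w \<notin> S \<longrightarrow> \<phi> w = 0)}"

text \<open>
  Expectation with values in the extended reals. The Bochner integral, and hence the library's
  \<open>entropy\<close>, is \<open>0\<close> for non-integrable integrands, which would give densities of entropy
  \<open>- \<infinity>\<close> a finite objective value in the minimization problem below. For densities supported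
  on a bounded set, the entropy below lies in \<open>[-\<infinity>, \<infinity>)\<close>, so \<open>\<infinity> - \<infinity>\<close> does not occur.
\<close>

definition ext_expectation :: "'a measure \<Rightarrow> ('a \<Rightarrow> ereal) \<Rightarrow> ereal" where
  "ext_expectation M f =
     enn2ereal (\<integral>\<^sup>+ w. e2ennreal (f w) \<partial>M) - enn2ereal (\<integral>\<^sup>+ w. e2ennreal (- f w) \<partial>M)"

definition Ent :: "(real ^ ('m::finite option) \<Rightarrow> real) \<Rightarrow> ereal" where
  "Ent \<phi> = ext_expectation (law \<phi>) (\<lambda>w. ereal (- ln (\<phi> w)))"

definition mean_of :: "(real ^ ('m::finite option) \<Rightarrow> real) \<Rightarrow> real ^ ('m option)" where
  "mean_of \<phi> = (\<integral> w. w \<partial>law \<phi>)"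

definition Cov :: "(real ^ ('m::finite option) \<Rightarrow> real) \<Rightarrow> real ^ ('m option) ^ ('m option)" where
  "Cov \<phi> = (\<chi> i j. \<integral> w. (w $ i - mean_of \<phi> $ i) * (w $ j - mean_of \<phi> $ j) \<partial>law \<phi>)"

definition F_obj ::
  "real \<Rightarrow> real \<Rightarrow> (nat \<Rightarrow> real ^ ('m::finite option)) \<Rightarrow> nat \<Rightarrow>
    (real ^ ('m option) \<Rightarrow> real) \<Rightarrow> ereal" where
  "F_obj lam \<mu> x s \<phi> = ext_expectation (law \<phi>) (L_fun lam x s) - ereal \<mu> * Ent \<phi>"

definition Fbar_obj ::
  "real \<Rightarrow> real \<Rightarrow> (nat \<Rightarrow> real ^ ('m::finite option)) \<Rightarrow> nat \<Rightarrow>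
    (real ^ ('m option) \<Rightarrow> real) \<Rightarrow> ereal" where
  "Fbar_obj lam \<mu> x s \<phi> =
     L_fun lam x s (mean_of \<phi>)
     + ereal (4 / 5 * trace (L_hess lam x s (mean_of \<phi>) ** Cov \<phi>))
     - ereal \<mu> * Ent \<phi>"

text \<open>
  The Bochner mean of a density without first moment is the zero vector, which is not in the
  simplex; hence the first constraint excludes such densities.
\<close>

definition feasible ::
  "real \<Rightarrow> (nat \<Rightarrow> real ^ ('m::finite option)) \<Rightarrow> nat \<Rightarrow> (real ^ ('m option) \<Rightarrow> real) set" where
  "feasible lam x s =
     {\<phi>. mean_of \<phi> \<in> rel_interior std_simplex \<and> \<phi> \<in> Supp (dikin lam x s (1 / 4) (mean_of \<phi>))}"

section \<open>Gaussians and truncation\<close>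

definition mv_normal_density :: "real ^ 'k \<Rightarrow> real ^ 'k ^ 'k \<Rightarrow> real ^ 'k::finite \<Rightarrow> real" where
  "mv_normal_density m S u =
     exp (- ((u - m) \<bullet> (matrix_inv S *v (u - m))) / 2) / sqrt ((2 * pi) ^ CARD('k) * det S)"

text \<open>
  The possibly degenerate Gaussian distribution with mean \<open>m\<close> and covariance \<open>B S B\<^sup>T\<close>, for
  positive definite \<open>S\<close>: the law of \<open>m + B u\<close> where \<open>u\<close> is centred Gaussian with covariance \<open>S\<close>.
\<close>

definition degenerate_normal ::
  "real ^ 'n \<Rightarrow> real ^ 'k ^ 'n \<Rightarrow> real ^ 'k ^ 'k \<Rightarrow> (real ^ 'n::finite) measure" where
  "degenerate_normal m B S =
     distr (density lborel (\<lambda>u. ennreal (mv_normal_density 0 S u))) borel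
       (\<lambda>u :: real ^ 'k::finite. m + B *v u)"

definition truncate_density ::
  "(real ^ ('m::finite option)) set \<Rightarrow> (real ^ ('m option) \<Rightarrow> real) \<Rightarrow> real ^ ('m option) \<Rightarrow> real" where
  "truncate_density E g w = indicator E w * g w / measure (law g) E"

end

theory Submission imports Defs begin

text \<open>
  Both objectives are compared with \<open>P = L + \<mu> V\<close>, through volumes of Dikin ellipsoids. Write \<open>q\<^sub>v(z)\<close>
  for \<open>z \<bullet> \<nabla>\<^sup>2L(v) z\<close> and \<open>W(v, r)\<close> for the volume of the Dikin ellipsoid of radius \<open>r\<close> around \<open>v\<close>.

  Upper bound. If \<open>q\<^sub>v(z) \<le> 1/4\<close>, then no argument of a logarithm in \<open>L\<close> changes by more than half between
  \<open>v\<close> and \<open>v + z\<close>, and \<open>- ln (1 + a) \<le> - a + 4/5 a\<^sup>2\<close> for \<open>\<bar>a\<bar> \<le> 1/2\<close>; hence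
  \<open>L(v + z) \<le> L(v) + \<nabla>L(v) \<bullet> z + 4/5 q\<^sub>v(z)\<close> (lemma \<open>L_fin_upper\<close>). The truncated Gaussian is symmetric
  about \<open>w\<^sub>t\<close>, so the linear term has mean zero. The logarithm of its density is a constant minus \<open>8 q\<close>, and
  for \<open>\<mu> \<ge> 1/10\<close> the term \<open>8 \<mu> q\<close> absorbs \<open>4/5 q\<close>. The constant is at most \<open>2 - ln W(w\<^sub>t, 1/2)\<close>, because
  \<open>exp (- 8 q) \<ge> exp (- 2)\<close> on the ellipsoid. So \<open>F\<close> is at most \<open>L(w\<^sub>t) + \<mu> (2 - ln W(w\<^sub>t, 1/2))\<close>
  (lemma \<open>F_obj_truncated_gaussian_le\<close>).

  Lower bound. The trace term is nonnegative and the entropy is at most the logarithm of the volume of the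
  support, so the optimal value is at least \<open>L(w) - \<mu> ln W(w, 1/4)\<close> for the mean \<open>w\<close> of the optimal density
  (lemma \<open>Fbar_obj_ge\<close>).

  Comparison. The volume \<open>W(v, r)\<close> is a dimensional constant times \<open>r\<^sup>d\<^sup>-\<^sup>1\<close> divided by the square root of
  \<open>det (A\<^sup>T \<nabla>\<^sup>2L(v) A)\<close> (lemma \<open>emeasure_dikin\<close>), that is \<open>- ln W(v, r) = V(v) - (d - 1) ln r\<close> up to a
  constant. The two bounds thus become \<open>P(w\<^sub>t)\<close> and \<open>P(w)\<close> with the same constant, and \<open>P(w\<^sub>t) \<le> P(w)\<close> since
  \<open>w\<^sub>t\<close> is the minimizer. The remaining gap \<open>2 \<mu> - \<mu> (d - 1) ln 2\<close> is below \<open>\<mu> (d - 1) ln (350 d) / 2\<close>.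
\<close>

section \<open>Linear images and volumes of ellipsoids\<close>

text \<open>
  By induction over elementary maps. The index type carries no order, so a shear has no triangular
  shape; its determinant comes from viewing it as a row operation on the identity, and that of a
  coordinate swap from the swap being an involution.
\<close>

lemma measure_linear_image_finite:
  fixes f :: "real^'n::finite \<Rightarrow> real^'n"
  assumes "linear f" and "S \<in> lmeasurable"
  shows "f ` S \<in> lmeasurable \<and> measure lebesgue (f ` S) = \<bar>det (matrix f)\<bar> * measure lebesgue S"
proof -
  define P where "P = (\<lambda>f :: real^'n \<Rightarrow> real^'n. \<forall>S\<in>lmeasurable. f ` S \<in> lmeasurable \<and>
     measure lebesgue (f ` S) = \<bar>det (matrix f)\<bar> * measure lebesgue S)"
  have unimodular: "P h"
    if "linear h" "\<bar>det (matrix h)\<bar> = 1"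
      "\<And>a b. cbox a b \<noteq> {} \<Longrightarrow> measure lebesgue (h ` cbox a b) = measure lebesgue (cbox a b)" for h
  proof -
    have box: "measure lebesgue (h ` cbox a b) = 1 * measure lebesgue (cbox a b)" for a b
      using that(3)[of a b] by (cases "cbox a b = {}") auto
    have "h ` S \<in> lmeasurable \<and> measure lebesgue (h ` S) = measure lebesgue S"
      if "S \<in> lmeasurable" for S
      using measure_linear_sufficient[OF \<open>linear h\<close> that, of 1] box by simp
    then show ?thesis
      using that(2) by (simp add: P_def)
  qed
  have "P f"
  proof (rule induct_linear_elementary[OF \<open>linear f\<close>])
    fix f g :: "real^'n \<Rightarrow> real^'n"
    assume "linear f" "linear g" "P f" "P g"
    moreover have "det (matrix (f \<circ> g)) = det (matrix f) * det (matrix g)"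
      using \<open>linear f\<close> \<open>linear g\<close> by (simp add: matrix_compose det_mul)
    ultimately show "P (f \<circ> g)"
      unfolding P_def image_comp[symmetric] by (simp add: abs_mult del: o_apply)
  next
    fix f :: "real^'n \<Rightarrow> real^'n" and i
    assume lin: "linear f" and zero: "\<And>x. f x $ i = 0"
    have "\<not> surj f"
      by (metis surjD zero axis_nth zero_neq_one)
    then have "\<not> inj f"
      using lin linear_injective_imp_surjective by blast
    then have "negligible (f ` S)" for S
      using lin negligible_linear_singular_image by blast
    then show "P f"
      using \<open>\<not> inj f\<close> det_nz_iff_inj[OF lin] unfolding P_def
      by (auto simp: negligible_iff_measure)
  next
    fix c :: "'n \<Rightarrow> real"
    have "det (matrix (\<lambda>x::real^'n. \<chi> i. c i * x $ i)) = prod c UNIV"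
      by (subst det_diagonal) (auto simp: matrix_def axis_def)
    then show "P (\<lambda>x. \<chi> i. c i * x $ i)"
      unfolding P_def by (simp add: measurable_stretch measure_stretch)
  next
    fix m n :: 'n
    assume "m \<noteq> n"
    define h :: "real^'n \<Rightarrow> real^'n" where "h = (\<lambda>x. \<chi> i. x $ Transposition.transpose m n i)"
    have lin: "linear h"
      by (rule linearI) (simp_all add: h_def vec_eq_iff)
    have inv: "h (h x) = x" for x
      by (simp add: h_def vec_eq_iff)
    have "det (matrix h) * det (matrix h) = det (matrix (h \<circ> h))"
      by (simp add: matrix_compose[OF lin lin] det_mul)
    also have "h \<circ> h = (\<lambda>x. x)"
      using inv by auto
    finally have "(det (matrix h))\<^sup>2 = 1"
      by (simp add: power2_eq_square matrix_id_mat_1 flip: id_def)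
    then have det: "\<bar>det (matrix h)\<bar> = 1"
      by (simp add: abs_square_eq_1)
    have "measure lebesgue (h ` cbox a b) = measure lebesgue (cbox a b)" if "cbox a b \<noteq> {}" for a b
    proof -
      have *: "x \<in> h ` cbox a b \<longleftrightarrow> h x \<in> cbox a b" for x
        by (metis inv image_iff)
      have "h ` cbox a b = cbox (h a) (h b)"
        unfolding set_eq_iff * by (auto simp: h_def mem_box_cart) (metis transpose_involutory)+
      moreover have "(\<Prod>i\<in>UNIV. h b $ i - h a $ i) = (\<Prod>i\<in>UNIV. b $ i - a $ i)"
        unfolding h_def
        by (rule prod.reindex_bij_witness[of _ "Transposition.transpose m n" "Transposition.transpose m n"]) auto
      moreover have "cbox (h a) (h b) \<noteq> {}"
        using that calculation(1) by auto
      ultimately show ?thesis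
        using that by (simp add: content_cbox_cart)
    qed
    then show "P (\<lambda>x. \<chi> i. x $ Transposition.transpose m n i)"
      using unimodular[OF lin det] by (simp add: h_def)
  next
    fix m n :: 'n
    assume "m \<noteq> n"
    define h :: "real^'n \<Rightarrow> real^'n" where "h = (\<lambda>x. \<chi> i. if i = m then x $ m + x $ n else x $ i)"
    have lin: "linear h"
      by (rule linearI) (auto simp: h_def vec_eq_iff algebra_simps)
    have "matrix h = (\<chi> k. if k = m then row m (mat 1) + 1 *s row n (mat 1) else row k (mat 1))"
      using \<open>m \<noteq> n\<close> by (auto simp: matrix_def h_def vec_eq_iff row_def mat_def axis_def)
    then have det: "\<bar>det (matrix h)\<bar> = 1"
      using det_row_operation[OF \<open>m \<noteq> n\<close>, of "mat 1 :: real^'n^'n" 1] by simp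
    have "measure lebesgue (h ` cbox a b) = measure lebesgue (cbox a b)" if "cbox a b \<noteq> {}" for a b
    proof -
      \<comment> \<open>the volume of a sheared box is known if its \<open>n\<close>-th lower bound is nonnegative; this translation makes it \<open>0\<close>\<close>
      define v where "v = axis n (a $ n)"
      have shift: "cbox a b = (+) v ` cbox (a - v) (b - v)"
        using cbox_translation[of v "a - v" "b - v"] by simp
      have "h ` cbox a b = (+) (h v) ` h ` cbox (a - v) (b - v)"
        unfolding shift image_image by (simp add: linear_add[OF lin])
      then have "measure lebesgue (h ` cbox a b) = measure lebesgue (h ` cbox (a - v) (b - v))"
        by (simp add: measure_translation)
      also have "\<dots> = measure lebesgue (cbox (a - v) (b - v))"
        unfolding h_def
        by (rule measure_shear_interval[OF \<open>m \<noteq> n\<close>]) (use that shift in \<open>auto simp: v_def\<close>)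
      also have "\<dots> = measure lebesgue (cbox a b)"
        unfolding shift by (simp only: measure_translation)
      finally show ?thesis .
    qed
    then show "P (\<lambda>x. \<chi> i. if i = m then x $ m + x $ n else x $ i)"
      using unimodular[OF lin det] by (simp add: h_def)
  qed
  then show ?thesis
    using assms(2) by (simp add: P_def)
qed

text \<open>
  A substitute for a Cholesky factorization. Given \<open>B\<close> for the first squares, the map
  \<open>u \<mapsto> (B u, a \<bullet> u)\<close> has the right norm but one dimension too many; its range has dimension at most
  that of the domain, so an isometry brings it back.
\<close>

lemma sum_of_squares_eq_norm:
  fixes a :: "'k \<Rightarrow> real^'m::finite"
  assumes "finite K"
  shows "\<exists>B :: real^'m^'m. \<forall>u. (norm (B *v u))\<^sup>2 = (\<Sum>k\<in>K. (a k \<bullet> u)\<^sup>2)"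
  using assms
proof (induction K)
  case empty
  then show ?case by (intro exI[of _ 0]) simp
next
  case (insert k K)
  then obtain B :: "real^'m^'m" where B: "\<And>u. (norm (B *v u))\<^sup>2 = (\<Sum>k\<in>K. (a k \<bullet> u)\<^sup>2)"
    by blast
  define M where "M u = (B *v u, a k \<bullet> u)" for u
  have linM: "linear M"
    by (rule linearI) (simp_all add: M_def algebra_simps inner_simps scaleR_matrix_vector_assoc
        matrix_vector_right_distrib matrix_vector_mult_scaleR)
  have "dim (range M) \<le> dim (UNIV :: (real^'m) set)"
    using dim_image_le[OF linM] by blast
  moreover have "subspace (range M)"
    using linM linear_subspace_image subspace_UNIV by blast
  ultimately obtain f :: "_ \<Rightarrow> real^'m"
    where f: "linear f" "\<And>y. y \<in> range M \<Longrightarrow> norm (f y) = norm y"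
    using isometry_subset_subspace[of "range M" "UNIV :: (real^'m) set"] by auto
  have "linear (f \<circ> M)"
    using linM f(1) linear_compose by blast
  then have "(norm (matrix (f \<circ> M) *v u))\<^sup>2 = (norm (M u))\<^sup>2" for u
    by (simp add: matrix_works f(2))
  also have "(norm (M u))\<^sup>2 = (\<Sum>k\<in>insert k K. (a k \<bullet> u)\<^sup>2)" for u
    using insert by (simp add: M_def norm_Pair B sum_nonneg)
  finally show ?case by blast
qed

text \<open>
  By polarization, which recovers \<open>u \<bullet> (M v)\<close> from the values of the quadratic form at \<open>u\<close>, \<open>v\<close> and \<open>u + v\<close>.
\<close>

lemma symmetric_matrix_eqI:
  fixes H G :: "real^'m::finite^'m"
  assumes "transpose H = H" "transpose G = G" "\<And>u. u \<bullet> (H *v u) = u \<bullet> (G *v u)"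
  shows "H = G"
proof -
  have polar: "2 * (u \<bullet> (M *v v)) = (u + v) \<bullet> (M *v (u + v)) - u \<bullet> (M *v u) - v \<bullet> (M *v v)"
    if "transpose M = M" for M :: "real^'m^'m" and u v
  proof -
    have "v \<bullet> (M *v u) = u \<bullet> (M *v v)"
      using that by (metis dot_lmul_matrix inner_commute transpose_matrix_vector)
    then show ?thesis
      by (simp add: matrix_vector_right_distrib inner_simps)
  qed
  have "u \<bullet> (H *v v) = u \<bullet> (G *v v)" for u v
    using polar[OF assms(1), of u v] polar[OF assms(2), of u v] assms(3) by simp
  then show ?thesis
    unfolding matrix_eq by (metis vector_eq_ldot)
qed

text \<open>
  The matrix \<open>H\<close> factors as \<open>B\<^sup>T B\<close>, and \<open>B\<close> maps the ellipsoid onto a ball of radius \<open>r\<close> while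
  scaling volumes by \<open>\<bar>det B\<bar> = sqrt (det H)\<close>.
\<close>

lemma ellipsoid_volume:
  fixes H :: "real^'m::finite^'m" and a :: "'k \<Rightarrow> real^'m"
  assumes "finite K" and sym: "transpose H = H"
    and quad: "\<And>u. u \<bullet> (H *v u) = (\<Sum>k\<in>K. (a k \<bullet> u)\<^sup>2)"
    and pos: "\<And>u. u \<noteq> 0 \<Longrightarrow> 0 < u \<bullet> (H *v u)"
  shows "0 < det H"
    and "0 \<le> r \<Longrightarrow> emeasure lborel {u. (u - c) \<bullet> (H *v (u - c)) < r\<^sup>2} =
      ennreal (unit_ball_vol (real CARD('m)) * r ^ CARD('m) / sqrt (det H))"
proof -
  obtain B :: "real^'m^'m" where B: "\<And>u. (norm (B *v u))\<^sup>2 = u \<bullet> (H *v u)"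
    using sum_of_squares_eq_norm[OF \<open>finite K\<close>, of a] quad by metis
  have "u \<bullet> (H *v u) = u \<bullet> ((transpose B ** B) *v u)" for u
    by (metis B dot_lmul_matrix matrix_vector_mul_assoc power2_norm_eq_inner
        transpose_matrix_vector transpose_transpose)
  then have "H = transpose B ** B"
    by (subst symmetric_matrix_eqI[OF sym, of "transpose B ** B"]) (auto simp: matrix_transpose_mul)
  then have det: "det H = (det B)\<^sup>2"
    by (simp add: det_mul power2_eq_square)
  have inj: "inj ((*v) B)"
    unfolding linear_injective_0[OF matrix_vector_mul_linear] using B pos
    by (metis less_irrefl norm_zero power_zero_numeral)
  then have "det B \<noteq> 0"
    using det_nz_iff_inj[of "(*v) B"] by simp
  then show pos_det: "0 < det H"
    using det by simp
  assume r: "0 \<le> r"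
  define E where "E = {u. (u - c) \<bullet> (H *v (u - c)) < r\<^sup>2}"
  have mem: "u \<in> E \<longleftrightarrow> B *v u \<in> ball (B *v c) r" for u
  proof -
    have "(u - c) \<bullet> (H *v (u - c)) = (dist (B *v c) (B *v u))\<^sup>2"
      unfolding B[symmetric] dist_norm norm_minus_commute[of "B *v c"]
      by (simp only: matrix_vector_mult_diff_distrib)
    moreover have "(dist (B *v c) (B *v u))\<^sup>2 < r\<^sup>2 \<longleftrightarrow> dist (B *v c) (B *v u) < r"
      using r power2_less_imp_less power_strict_mono zero_le_dist zero_less_numeral by metis
    ultimately show ?thesis
      by (simp only: E_def mem_Collect_eq mem_ball)
  qed
  obtain g where g: "linear g" "\<And>u. g (B *v u) = u" "\<And>u. B *v g u = u"
    using linear_injective_isomorphism[OF matrix_vector_mul_linear inj] by blast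
  have img: "E = g ` ball (B *v c) r"
  proof (intro set_eqI iffI)
    fix u assume "u \<in> E"
    then show "u \<in> g ` ball (B *v c) r"
      using mem[of u] g(2)[of u] by (intro image_eqI[of u g "B *v u"]) simp_all
  next
    fix u assume "u \<in> g ` ball (B *v c) r"
    then obtain y where "u = g y" "y \<in> ball (B *v c) r"
      by blast
    then show "u \<in> E"
      using mem[of u] g(3)[of y] by simp
  qed
  have img2: "(*v) B ` E = ball (B *v c) r"
    unfolding img image_image g(3) by simp
  have meas: "E \<in> lmeasurable"
    unfolding img using measure_linear_image_finite[OF g(1)] by simp
  have "unit_ball_vol (real CARD('m)) * r ^ CARD('m) = measure lebesgue ((*v) B ` E)"
    using r content_ball[of r "B *v c"] img2 by simp
  also have "\<dots> = \<bar>det B\<bar> * measure lebesgue E"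
    using measure_linear_image_finite[OF _ meas, of "(*v) B"] by simp
  finally have "measure lebesgue E = unit_ball_vol (real CARD('m)) * r ^ CARD('m) / sqrt (det H)"
    using \<open>det B \<noteq> 0\<close> by (simp add: det field_simps)
  moreover have "E \<in> sets borel"
  proof -
    have "continuous_on UNIV (\<lambda>u. H *v (u - c))"
      by (intro linear_continuous_on_compose[OF _ matrix_vector_mul_linear] continuous_intros)
    then show ?thesis
      unfolding E_def by (intro borel_open open_Collect_less continuous_intros)
  qed
  ultimately have "emeasure lborel E = ennreal (unit_ball_vol (real CARD('m)) * r ^ CARD('m) / sqrt (det H))"
    using meas emeasure_eq_measure2[of E lebesgue] by (simp add: emeasure_completion)
  then show "emeasure lborel {u. (u - c) \<bullet> (H *v (u - c)) < r\<^sup>2} =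
      ennreal (unit_ball_vol (real CARD('m)) * r ^ CARD('m) / sqrt (det H))"
    by (simp only: E_def)
qed

section \<open>Derivatives of the logarithmic barrier\<close>

text \<open>
  \<open>L_lin\<close> and \<open>L_quad\<close> are the first derivative \<open>\<nabla>L(v) \<bullet> z\<close> and the second derivative
  \<open>z \<bullet> \<nabla>\<^sup>2L(v) z\<close> of \<open>L\<close> in closed form: sums over the arguments of the logarithms of the relative
  changes, respectively of their squares.
\<close>

definition L_lin :: "real \<Rightarrow> (nat \<Rightarrow> real ^ 'n::finite) \<Rightarrow> nat \<Rightarrow> real ^ 'n \<Rightarrow> real ^ 'n \<Rightarrow> real" where
  "L_lin lam x s v z = - (\<Sum>\<tau>=1..s. (x \<tau> \<bullet> z) / (x \<tau> \<bullet> v)) - lam * (\<Sum>i\<in>UNIV. z $ i / v $ i)"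

definition L_quad :: "real \<Rightarrow> (nat \<Rightarrow> real ^ 'n::finite) \<Rightarrow> nat \<Rightarrow> real ^ 'n \<Rightarrow> real ^ 'n \<Rightarrow> real" where
  "L_quad lam x s v z = (\<Sum>\<tau>=1..s. ((x \<tau> \<bullet> z) / (x \<tau> \<bullet> v))\<^sup>2) + lam * (\<Sum>i\<in>UNIV. (z $ i / v $ i)\<^sup>2)"

definition admissible :: "(nat \<Rightarrow> real ^ 'n::finite) \<Rightarrow> nat \<Rightarrow> bool" where
  "admissible x s \<longleftrightarrow> (\<forall>\<tau>\<in>{1..s}. (\<forall>i. 0 \<le> x \<tau> $ i) \<and> x \<tau> \<noteq> 0)"

lemma admissible_inner_pos:
  assumes "admissible x s" "\<tau> \<in> {1..s}" "w \<in> pos_orthant"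
  shows "0 < x \<tau> \<bullet> w"
proof -
  have nonneg: "\<And>i. 0 \<le> x \<tau> $ i" and "x \<tau> \<noteq> 0"
    using assms by (auto simp: admissible_def)
  then obtain k where "x \<tau> $ k \<noteq> 0"
    by (auto simp: vec_eq_iff)
  then have "0 < x \<tau> $ k * w $ k"
    using nonneg[of k] assms(3) by (simp add: pos_orthant_def)
  then show ?thesis
    unfolding inner_vec_def
    using nonneg assms(3) by (intro sum_pos2[where i = k]) (auto simp: pos_orthant_def less_imp_le)
qed

lemma open_pos_orthant: "open (pos_orthant :: (real ^ 'n::finite) set)"
proof -
  have "(pos_orthant :: (real^'n) set) = (\<Inter>i. {w :: real^'n. 0 < w $ i})"
    by (auto simp: pos_orthant_def)
  also have "open \<dots>"
    using open_halfspace_component_gt_cart by (intro open_INT) auto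
  finally show ?thesis .
qed

lemma L_fin_directional_derivative:
  assumes adm: "admissible x n" and w: "w \<in> pos_orthant"
  shows "((\<lambda>s. L_fin lam x n (w + s *\<^sub>R z)) has_real_derivative L_lin lam x n w z) (at 0)"
proof -
  have "((\<lambda>s. ln (x \<tau> \<bullet> w + s * (x \<tau> \<bullet> z))) has_real_derivative (x \<tau> \<bullet> z) / (x \<tau> \<bullet> w)) (at 0)"
    if "\<tau> \<in> {1..n}" for \<tau>
    using admissible_inner_pos[OF adm that w] by (auto intro!: derivative_eq_intros)
  then have x_part: "((\<lambda>s. \<Sum>\<tau>=1..n. - ln (x \<tau> \<bullet> w + s * (x \<tau> \<bullet> z))) has_real_derivative
      (\<Sum>\<tau>=1..n. - ((x \<tau> \<bullet> z) / (x \<tau> \<bullet> w)))) (at 0)"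
    by (intro DERIV_sum DERIV_minus)
  have "((\<lambda>s. ln (w $ i + s * z $ i)) has_real_derivative z $ i / w $ i) (at 0)" for i
    using w by (auto intro!: derivative_eq_intros simp: pos_orthant_def)
  then have barrier: "((\<lambda>s. lam * (\<Sum>i\<in>UNIV. ln (w $ i + s * z $ i))) has_real_derivative
      lam * (\<Sum>i\<in>UNIV. z $ i / w $ i)) (at 0)"
    by (intro DERIV_cmult DERIV_sum)
  from DERIV_diff[OF x_part barrier] show ?thesis
    by (simp add: L_fin_def L_lin_def inner_add_right sum_negf)
qed

lemma L_lin_axis:
  "L_lin lam x n w (axis j 1) = - (\<Sum>\<tau>=1..n. x \<tau> $ j / (x \<tau> \<bullet> w)) - lam / w $ j"
proof -
  have "(\<Sum>i\<in>UNIV. axis j 1 $ i / w $ i) = (\<Sum>i\<in>UNIV. if i = j then 1 / w $ j else 0)"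
    by (rule sum.cong) (auto simp: axis_def)
  then show ?thesis
    by (simp add: L_lin_def inner_axis)
qed

lemma L_hess_nth:
  assumes adm: "admissible x n" and v: "v \<in> pos_orthant"
  shows "L_hess lam x n v $ i $ j =
    (\<Sum>\<tau>=1..n. x \<tau> $ i * x \<tau> $ j / (x \<tau> \<bullet> v)\<^sup>2) + (if i = j then lam / (v $ i)\<^sup>2 else 0)"
proof -
  define D where "D w = - (\<Sum>\<tau>=1..n. x \<tau> $ j / (x \<tau> \<bullet> w)) - lam / w $ j" for w
  define e :: "real^'a" where "e = axis i 1"
  have D: "partial_deriv j (L_fin lam x n) w = D w" if "w \<in> pos_orthant" for w
    unfolding partial_deriv_def D_def
    using DERIV_imp_deriv[OF L_fin_directional_derivative[OF adm that, of lam "axis j 1"]]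
    by (simp only: L_lin_axis)
  \<comment> \<open>the formula for the first partial derivative is differentiated once more;
      it holds on the positive orthant only, which suffices because that set is open\<close>
  have "((\<lambda>s. x \<tau> $ j / (x \<tau> \<bullet> v + s * x \<tau> $ i)) has_real_derivative
      - (x \<tau> $ i * x \<tau> $ j / (x \<tau> \<bullet> v)\<^sup>2)) (at 0)" if "\<tau> \<in> {1..n}" for \<tau>
    using admissible_inner_pos[OF adm that v]
    by (auto intro!: derivative_eq_intros simp: power2_eq_square)
  then have x_part: "((\<lambda>s. - (\<Sum>\<tau>=1..n. x \<tau> $ j / (x \<tau> \<bullet> v + s * x \<tau> $ i))) has_real_derivative
      - (\<Sum>\<tau>=1..n. - (x \<tau> $ i * x \<tau> $ j / (x \<tau> \<bullet> v)\<^sup>2))) (at 0)"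
    by (intro DERIV_sum DERIV_minus)
  have "v $ j > 0"
    using v by (simp add: pos_orthant_def)
  then have barrier: "((\<lambda>s. lam / (v $ j + s * e $ j)) has_real_derivative
      - (lam * e $ j / (v $ j)\<^sup>2)) (at 0)"
    by (auto intro!: derivative_eq_intros simp: power2_eq_square)
  have "((\<lambda>s. D (v + s *\<^sub>R e)) has_real_derivative
      (\<Sum>\<tau>=1..n. x \<tau> $ i * x \<tau> $ j / (x \<tau> \<bullet> v)\<^sup>2) + lam * e $ j / (v $ j)\<^sup>2) (at 0)"
    using DERIV_diff[OF x_part barrier]
    by (simp add: D_def e_def inner_add_right inner_axis sum_negf)
  moreover have "open {s. v + s *\<^sub>R e \<in> pos_orthant}"
    using open_vimage[OF open_pos_orthant, of "\<lambda>s. v + s *\<^sub>R e"]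
    by (simp add: vimage_def continuous_intros)
  ultimately have "((\<lambda>s. partial_deriv j (L_fin lam x n) (v + s *\<^sub>R e)) has_real_derivative
      (\<Sum>\<tau>=1..n. x \<tau> $ i * x \<tau> $ j / (x \<tau> \<bullet> v)\<^sup>2) + lam * e $ j / (v $ j)\<^sup>2) (at 0)"
    by (rule has_field_derivative_transform_within_open) (use v D in auto)
  then have "L_hess lam x n v $ i $ j =
      (\<Sum>\<tau>=1..n. x \<tau> $ i * x \<tau> $ j / (x \<tau> \<bullet> v)\<^sup>2) + lam * e $ j / (v $ j)\<^sup>2"
    by (simp add: L_hess_def hessian_def partial_deriv_def[of i] DERIV_imp_deriv flip: e_def)
  then show ?thesis
    by (auto simp: e_def axis_def)
qed

lemma L_hess_symmetric:
  assumes "admissible x n" "v \<in> pos_orthant"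
  shows "transpose (L_hess lam x n v) = L_hess lam x n v"
  by (auto simp: vec_eq_iff transpose_def L_hess_nth[OF assms] mult.commute)

lemma L_hess_quadratic_form:
  assumes adm: "admissible x n" and v: "v \<in> pos_orthant"
  shows "z \<bullet> (L_hess lam x n v *v z) = L_quad lam x n v z"
proof -
  have "(L_hess lam x n v *v z) $ i =
      (\<Sum>\<tau>=1..n. x \<tau> $ i * ((x \<tau> \<bullet> z) / (x \<tau> \<bullet> v)\<^sup>2)) + lam * z $ i / (v $ i)\<^sup>2" for i
  proof -
    have "(L_hess lam x n v *v z) $ i =
        (\<Sum>j\<in>UNIV. \<Sum>\<tau>=1..n. x \<tau> $ i * x \<tau> $ j / (x \<tau> \<bullet> v)\<^sup>2 * z $ j)
        + (\<Sum>j\<in>UNIV. if i = j then lam / (v $ i)\<^sup>2 * z $ j else 0)"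
      unfolding matrix_vector_mult_def L_hess_nth[OF adm v]
      by (simp add: distrib_right sum.distrib sum_distrib_right if_distrib[of "\<lambda>y. y * _"] cong: if_cong)
    also have "(\<Sum>j\<in>UNIV. \<Sum>\<tau>=1..n. x \<tau> $ i * x \<tau> $ j / (x \<tau> \<bullet> v)\<^sup>2 * z $ j) =
        (\<Sum>\<tau>=1..n. x \<tau> $ i * ((x \<tau> \<bullet> z) / (x \<tau> \<bullet> v)\<^sup>2))"
      by (subst sum.swap) (simp add: inner_vec_def sum_distrib_left sum_divide_distrib mult_ac)
    finally show ?thesis by simp
  qed
  then have "z \<bullet> (L_hess lam x n v *v z) =
      (\<Sum>i\<in>UNIV. \<Sum>\<tau>=1..n. z $ i * (x \<tau> $ i * ((x \<tau> \<bullet> z) / (x \<tau> \<bullet> v)\<^sup>2)))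
      + (\<Sum>i\<in>UNIV. lam * (z $ i / v $ i)\<^sup>2)"
    by (simp add: inner_vec_def[of z] distrib_left sum.distrib sum_distrib_left power2_eq_square mult_ac)
  also have "(\<Sum>i\<in>UNIV. \<Sum>\<tau>=1..n. z $ i * (x \<tau> $ i * ((x \<tau> \<bullet> z) / (x \<tau> \<bullet> v)\<^sup>2))) =
      (\<Sum>\<tau>=1..n. (x \<tau> \<bullet> z) * ((x \<tau> \<bullet> z) / (x \<tau> \<bullet> v)\<^sup>2))"
    unfolding inner_vec_def[of "x _" z] sum_distrib_right
    by (subst sum.swap) (simp add: mult_ac)
  finally show ?thesis
    by (simp add: L_quad_def power2_eq_square sum_distrib_left)
qed

text \<open>
  The left endpoint decides how small the constant can be: at \<open>a = -1/2\<close> the inequality reads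
  \<open>ln 2 \<le> 7/10\<close>, which \<open>4/5\<close> meets narrowly.
\<close>

lemma neg_ln_add_one_le:
  fixes a :: real
  assumes "\<bar>a\<bar> \<le> 1 / 2"
  shows "- ln (1 + a) \<le> - a + 4 / 5 * a\<^sup>2"
proof -
  define h where "h y = ln (1 + y) - y + 4 / 5 * y\<^sup>2" for y :: real
  have deriv: "(h has_real_derivative y * (3 / 5 + 8 / 5 * y) / (1 + y)) (at y)" if "- 1 < y" for y
    unfolding h_def using that
    by (auto intro!: derivative_eq_intros simp: field_simps power2_eq_square)
  \<comment> \<open>the derivative of \<open>h\<close> changes sign at \<open>0\<close> and at \<open>- 3 / 8\<close>,
      so \<open>h\<close> is smallest at \<open>0\<close> or at \<open>- 1 / 2\<close>\<close>
  consider "0 \<le> a" | "- 3 / 8 \<le> a" "a \<le> 0" | "- 1 / 2 \<le> a" "a \<le> - 3 / 8"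
    using assms by linarith
  then have "0 \<le> h a"
  proof cases
    case 1
    have "h 0 \<le> h a"
    proof (rule DERIV_nonneg_imp_nondecreasing[OF 1])
      fix y :: real assume y: "0 \<le> y" "y \<le> a"
      then have "0 \<le> y * (3 / 5 + 8 / 5 * y) / (1 + y)"
        by simp
      with deriv[of y] y show "\<exists>d. (h has_real_derivative d) (at y) \<and> 0 \<le> d"
        by force
    qed
    then show ?thesis by (simp add: h_def)
  next
    case 2
    have "h 0 \<le> h a"
    proof (rule DERIV_nonpos_imp_nonincreasing[OF 2(2)])
      fix y assume y: "a \<le> y" "y \<le> 0"
      with 2 have "y * (3 / 5 + 8 / 5 * y) / (1 + y) \<le> 0"
        by (intro divide_nonpos_pos mult_nonpos_nonneg) auto
      with deriv[of y] 2 y show "\<exists>d. (h has_real_derivative d) (at y) \<and> d \<le> 0"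
        by force
    qed
    then show ?thesis by (simp add: h_def)
  next
    case 3
    have "h (- 1 / 2) \<le> h a"
    proof (rule DERIV_nonneg_imp_nondecreasing[OF 3(1)])
      fix y assume y: "- 1 / 2 \<le> y" "y \<le> a"
      with 3 have "0 \<le> y * (3 / 5 + 8 / 5 * y) / (1 + y)"
        by (intro divide_nonneg_pos mult_nonpos_nonpos) auto
      with deriv[of y] 3 y show "\<exists>d. (h has_real_derivative d) (at y) \<and> 0 \<le> d"
        by force
    qed
    moreover have "h (- 1 / 2) = 7 / 10 - ln 2"
      using ln_div[of 1 2] by (simp add: h_def power2_eq_square)
    ultimately show ?thesis
      using ln2_le_25_over_36 by linarith
  qed
  then show ?thesis
    by (simp add: h_def)
qed

text \<open>
  Each summand of \<open>L_quad\<close> is a square bounded by the whole, so inside a Dikin ellipsoid of radius \<open>1/2\<close>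
  no argument of a logarithm changes by more than half. The condition \<open>lam \<ge> 1\<close> gives this for the
  coordinates themselves.
\<close>

lemma L_quad_small:
  assumes lam: "1 \<le> lam" and v: "v \<in> pos_orthant" and small: "L_quad lam x n v z \<le> 1 / 4"
  shows "\<And>\<tau>. \<tau> \<in> {1..n} \<Longrightarrow> \<bar>(x \<tau> \<bullet> z) / (x \<tau> \<bullet> v)\<bar> \<le> 1 / 2"
    and "\<And>i. \<bar>z $ i / v $ i\<bar> \<le> 1 / 2"
proof -
  have half: "\<bar>y\<bar> \<le> 1 / 2" if "y\<^sup>2 \<le> 1 / 4" for y :: real
    using that abs_le_square_iff[of y "1 / 2"] by (simp add: power2_eq_square)
  let ?S = "\<Sum>\<tau>=1..n. ((x \<tau> \<bullet> z) / (x \<tau> \<bullet> v))\<^sup>2" and ?R = "\<Sum>i\<in>UNIV. (z $ i / v $ i)\<^sup>2"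
  have nonneg: "0 \<le> ?S" "0 \<le> ?R"
    by (simp_all add: sum_nonneg)
  then have "?R \<le> lam * ?R" "0 \<le> lam * ?R"
    using lam by (simp_all add: mult_le_cancel_right1)
  then have S: "?S \<le> 1 / 4" and R: "?R \<le> 1 / 4"
    using small nonneg unfolding L_quad_def by linarith+
  show "\<bar>(x \<tau> \<bullet> z) / (x \<tau> \<bullet> v)\<bar> \<le> 1 / 2" if "\<tau> \<in> {1..n}" for \<tau>
    by (rule half, rule order_trans[OF _ S], rule member_le_sum[OF that]) auto
  show "\<bar>z $ i / v $ i\<bar> \<le> 1 / 2" for i
    by (rule half, rule order_trans[OF _ R], rule member_le_sum) auto
qed

lemma L_quad_small_component:
  assumes "1 \<le> lam" "v \<in> pos_orthant" "L_quad lam x n v z \<le> 1 / 4"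
  shows "\<bar>z $ i\<bar> \<le> v $ i / 2"
proof -
  have "0 < v $ i"
    using assms(2) by (simp add: pos_orthant_def)
  then show ?thesis
    using L_quad_small(2)[OF assms, of i] by (simp add: pos_divide_le_eq)
qed

text \<open>
  A self-concordance estimate with explicit constant. Since \<open>L\<close> is a sum of negative logarithms of linear
  forms, the scalar inequality for each of them suffices; the squares add up to \<open>L_quad\<close>.
\<close>

lemma L_fin_upper:
  assumes adm: "admissible x n" and lam: "1 \<le> lam" and v: "v \<in> pos_orthant"
    and small: "L_quad lam x n v z \<le> 1 / 4"
  shows "v + z \<in> pos_orthant"
    and "L_fin lam x n (v + z) \<le> L_fin lam x n v + L_lin lam x n v z + 4 / 5 * L_quad lam x n v z"
proof -
  have step: "- ln (p + q) \<le> - ln p - q / p + 4 / 5 * (q / p)\<^sup>2" if "0 < p" "\<bar>q / p\<bar> \<le> 1 / 2" for p q :: real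
  proof -
    have "p + q = p * (1 + q / p)"
      using that by (simp add: field_simps)
    then have "- ln (p + q) = - ln p - ln (1 + q / p)"
      using that(2) ln_mult_pos[OF that(1), of "1 + q / p"] by (simp only: abs_le_iff) linarith
    then show ?thesis
      using neg_ln_add_one_le[OF that(2)] by linarith
  qed
  have vpos: "0 < v $ i" for i
    using v by (simp add: pos_orthant_def)
  have "0 < v $ i + z $ i" for i
    using L_quad_small_component[OF lam v small, of i] vpos[of i] by linarith
  then show "v + z \<in> pos_orthant"
    by (simp add: pos_orthant_def)
  have "(\<Sum>\<tau>=1..n. - ln (x \<tau> \<bullet> (v + z))) \<le>
      (\<Sum>\<tau>=1..n. - ln (x \<tau> \<bullet> v) - (x \<tau> \<bullet> z) / (x \<tau> \<bullet> v) + 4 / 5 * ((x \<tau> \<bullet> z) / (x \<tau> \<bullet> v))\<^sup>2)"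
    unfolding inner_add_right
    by (intro sum_mono step admissible_inner_pos[OF adm _ v] L_quad_small(1)[OF lam v small])
  moreover have "(\<Sum>i\<in>UNIV. - ln ((v + z) $ i)) \<le>
      (\<Sum>i\<in>UNIV. - ln (v $ i) - z $ i / v $ i + 4 / 5 * (z $ i / v $ i)\<^sup>2)"
    unfolding vector_add_component
    by (intro sum_mono step vpos L_quad_small(2)[OF lam v small])
  then have "lam * (\<Sum>i\<in>UNIV. - ln ((v + z) $ i)) \<le>
      lam * (\<Sum>i\<in>UNIV. - ln (v $ i) - z $ i / v $ i + 4 / 5 * (z $ i / v $ i)\<^sup>2)"
    using lam by (intro mult_left_mono) auto
  ultimately show "L_fin lam x n (v + z) \<le> L_fin lam x n v + L_lin lam x n v z + 4 / 5 * L_quad lam x n v z"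
    unfolding L_fin_def L_lin_def L_quad_def
    by (simp add: sum.distrib sum_subtractf sum_negf sum_distrib_left[symmetric] sum_divide_distrib[symmetric] algebra_simps)
qed

section \<open>The hyperplane and the volume of Dikin ellipsoids\<close>

text \<open>
  Everything on the hyperplane is pulled back to \<open>\<real>\<^sup>d\<^sup>-\<^sup>1\<close> along the affine parametrization that defines its
  Lebesgue measure, with the first \<open>d - 1\<close> coordinates as inverse.
\<close>

definition plane_param :: "real ^ 'm \<Rightarrow> real ^ ('m::finite option)" where
  "plane_param u = Amat *v u + axis None 1"

definition plane_coord :: "real ^ ('m::finite option) \<Rightarrow> real ^ 'm" where
  "plane_coord w = (\<chi> i. w $ Some i)"

definition area_factor :: "'m::finite itself \<Rightarrow> real" where
  "area_factor _ = sqrt (det (transpose Amat ** (Amat :: real ^ 'm ^ ('m option))))"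

lemma sum_UNIV_option: "(\<Sum>k\<in>UNIV. f k) = f None + (\<Sum>i\<in>UNIV. f (Some i))" for f :: "'m::finite option \<Rightarrow> real"
  by (simp add: UNIV_option_conv sum.reindex)

lemma Amat_mult_nth:
  "(Amat *v u) $ Some i = u $ i"
  "(Amat *v u) $ None = - (\<Sum>j\<in>UNIV. u $ j)"
  by (simp_all add: Amat_def matrix_vector_mult_def if_distrib[of "\<lambda>y. y * _"] sum_negf cong: if_cong)

lemma Amat_mult_eq_0_iff: "Amat *v u = 0 \<longleftrightarrow> u = 0"
proof
  assume "Amat *v u = 0"
  then have "u $ i = 0" for i
    using Amat_mult_nth(1)[of u i] by simp
  then show "u = 0"
    by (simp add: vec_eq_iff)
qed simp

lemma plane_coord_param: "plane_coord (plane_param u) = u"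
  by (simp add: plane_coord_def plane_param_def Amat_mult_nth vec_eq_iff axis_def)

lemma plane_param_mem: "plane_param u \<in> aff_plane"
  by (simp add: plane_param_def aff_plane_def sum_UNIV_option Amat_mult_nth axis_def)

lemma plane_param_coord:
  assumes "w \<in> aff_plane"
  shows "plane_param (plane_coord w) = w"
proof -
  have "w $ None = 1 - (\<Sum>i\<in>UNIV. w $ Some i)"
    using assms by (simp add: aff_plane_def sum_UNIV_option)
  then have "plane_param (plane_coord w) $ k = w $ k" for k
    by (cases k) (simp_all add: plane_param_def plane_coord_def Amat_mult_nth axis_def)
  then show ?thesis
    by (simp add: vec_eq_iff)
qed

lemma plane_param_diff: "plane_param u - plane_param u' = Amat *v (u - u')"
  by (simp add: plane_param_def matrix_vector_mult_diff_distrib)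

lemma plane_param_measurable [measurable]: "plane_param \<in> borel_measurable borel"
  unfolding plane_param_def
  by (intro borel_measurable_continuous_onI continuous_intros
      linear_continuous_on_compose[OF continuous_on_id matrix_vector_mul_linear, simplified])

lemma plane_coord_measurable [measurable]: "plane_coord \<in> borel_measurable borel"
  unfolding plane_coord_def
  by (intro borel_measurable_continuous_onI continuous_intros)

lemma aff_plane_measurable [measurable]: "aff_plane \<in> sets borel"
proof -
  have "aff_plane = {w :: real^'n. (\<Sum>i\<in>UNIV. w $ i) = 1}"
    by (simp add: aff_plane_def)
  also have "\<dots> \<in> sets borel"
    by (intro borel_closed closed_Collect_eq continuous_intros)
  finally show ?thesis .
qed

lemma dikin_measurable [measurable]: "dikin lam x n r v \<in> sets borel"
proof -
  have "continuous_on UNIV (\<lambda>w. L_hess lam x n v *v (w - v))"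
    by (intro linear_continuous_on_compose[OF _ matrix_vector_mul_linear] continuous_intros)
  then have "open {w. (w - v) \<bullet> (L_hess lam x n v *v (w - v)) < r\<^sup>2}"
    by (intro open_Collect_less continuous_intros)
  then show ?thesis
    unfolding dikin_def using aff_plane_measurable by (simp add: Collect_conj_eq borel_open)
qed

lemma plane_lborel_eq:
  "(plane_lborel :: (real ^ ('m::finite option)) measure) =
    distr (density lborel (\<lambda>_. ennreal (area_factor TYPE('m)))) borel plane_param"
  by (simp add: plane_lborel_def area_factor_def plane_param_def[abs_def])

lemma sets_plane_lborel [measurable_cong, simp]: "sets plane_lborel = sets borel"
  by (simp add: plane_lborel_def)

lemma space_plane_lborel [simp]: "space plane_lborel = UNIV"
  by (simp add: plane_lborel_def)

lemma area_factor_pos: "0 < area_factor TYPE('m::finite)"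
proof -
  let ?A = "Amat :: real ^ 'm ^ ('m option)"
  have quad: "u \<bullet> ((transpose ?A ** ?A) *v u) = (norm (?A *v u))\<^sup>2" for u
    by (metis dot_lmul_matrix matrix_vector_mul_assoc power2_norm_eq_inner
        transpose_matrix_vector transpose_transpose)
  have squares: "(norm (?A *v u))\<^sup>2 = (\<Sum>k\<in>UNIV. (row k ?A \<bullet> u)\<^sup>2)" for u
    unfolding power2_norm_eq_inner
    by (simp add: inner_vec_def[of "?A *v u"] matrix_vector_mul_component row_def power2_eq_square)
  have "0 < det (transpose ?A ** ?A)"
  proof (rule ellipsoid_volume(1))
    show "0 < u \<bullet> ((transpose ?A ** ?A) *v u)" if "u \<noteq> 0" for u
      unfolding quad using that by (simp add: Amat_mult_eq_0_iff)
    show "u \<bullet> ((transpose ?A ** ?A) *v u) = (\<Sum>k\<in>UNIV. (row k ?A \<bullet> u)\<^sup>2)" for u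
      unfolding quad by (rule squares)
  qed (simp_all add: matrix_transpose_mul)
  then show ?thesis
    by (simp add: area_factor_def)
qed

lemma AE_plane_lborelI:
  assumes "{w. P w} \<in> sets borel" "AE u in lborel. P (plane_param u)"
  shows "AE w in (plane_lborel :: (real ^ ('m::finite option)) measure). P w"
  unfolding plane_lborel_eq using assms
  by (subst AE_distr_iff) (auto simp: AE_density)

lemma AE_plane_lborel_mem: "AE w in plane_lborel. w \<in> aff_plane"
  by (rule AE_plane_lborelI) (simp_all add: plane_param_mem)

text \<open>
  This symmetry is what makes the linear term of \<open>L\<close> average to zero under the truncated Gaussian.
\<close>

lemma plane_lborel_reflect:
  assumes "v \<in> aff_plane"
  shows "distr plane_lborel borel (\<lambda>w. 2 *\<^sub>R v - w) = (plane_lborel :: (real ^ ('m::finite option)) measure)"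
proof -
  let ?c = "\<lambda>_. ennreal (area_factor TYPE('m))"
  define R where "R u = 2 *\<^sub>R plane_coord v - u" for u
  have R_meas [measurable]: "R \<in> borel_measurable borel"
    by (simp add: R_def[abs_def])
  have "2 *\<^sub>R v - plane_param u = plane_param (R u)" for u
  proof -
    have "v - plane_param u = plane_param (R u) - v"
      using plane_param_diff[of "plane_coord v" u] plane_param_diff[of "R u" "plane_coord v"]
      by (simp add: plane_param_coord[OF assms] R_def scaleR_2)
    then show ?thesis
      by (simp add: scaleR_2 algebra_simps)
  qed
  then have comm: "(\<lambda>w. 2 *\<^sub>R v - w) \<circ> plane_param = plane_param \<circ> R"
    by auto
  have "distr lborel borel R = (lborel :: (real^'m) measure)"
    using lborel_affine[of "-1" "2 *\<^sub>R plane_coord v :: real^'m"]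
    by (simp add: density_1 R_def[abs_def])
  then have dens: "density lborel ?c = distr (density lborel ?c) borel R"
    using density_distr[of ?c borel R lborel] by simp
  have "distr plane_lborel borel (\<lambda>w. 2 *\<^sub>R v - w) =
      distr (density lborel ?c) borel (plane_param \<circ> R)"
    unfolding plane_lborel_eq by (subst distr_distr) (simp_all add: comm)
  also have "\<dots> = distr (distr (density lborel ?c) borel R) borel plane_param"
    by (subst distr_distr) simp_all
  finally show ?thesis
    by (simp add: plane_lborel_eq flip: dens)
qed

lemma inner_transpose_mult: "(transpose A *v y) \<bullet> u = y \<bullet> (A *v u)" for A :: "real^'m^'n"
  by (metis dot_lmul_matrix transpose_matrix_vector)

lemma red_hess_quadratic_form:
  assumes "admissible x n" "v \<in> pos_orthant"
  shows "u \<bullet> (red_hess lam x n v *v u) = L_quad lam x n v (Amat *v u)"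
proof -
  have "u \<bullet> (red_hess lam x n v *v u) = (Amat *v u) \<bullet> (L_hess lam x n v *v (Amat *v u))"
    unfolding red_hess_def
    by (simp only: matrix_vector_mul_assoc[symmetric] inner_commute[of u] inner_transpose_mult inner_commute[of "Amat *v u"])
  then show ?thesis
    by (simp add: L_hess_quadratic_form[OF assms])
qed

lemma L_quad_nonneg:
  assumes "0 \<le> lam"
  shows "0 \<le> L_quad lam x n v z"
  using assms by (simp add: L_quad_def sum_nonneg)

lemma L_quad_pos:
  assumes "0 < lam" "v \<in> pos_orthant" "z \<noteq> 0"
  shows "0 < L_quad lam x n v z"
proof -
  obtain i where "z $ i \<noteq> 0"
    using \<open>z \<noteq> 0\<close> by (auto simp: vec_eq_iff)
  moreover have "v $ i > 0"
    using assms by (simp add: pos_orthant_def)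
  ultimately have "0 < (\<Sum>i\<in>UNIV. (z $ i / v $ i)\<^sup>2)"
    by (intro sum_pos2[where i = i]) auto
  then show ?thesis
    using assms(1) by (simp add: L_quad_def add_nonneg_pos sum_nonneg)
qed

text \<open>
  The quadratic form of the reduced Hessian is a sum of squares with one square for each logarithm, and
  the barrier part makes it definite because \<open>A\<close> is injective.
\<close>

lemma red_hess_ellipsoid:
  assumes adm: "admissible x n" and lam: "0 < lam" and v: "v \<in> pos_orthant"
  shows "0 < det (red_hess lam x n (v :: real ^ ('m::finite option)))"
    and "0 \<le> r \<Longrightarrow> emeasure lborel {u. (u - c) \<bullet> (red_hess lam x n v *v (u - c)) < r\<^sup>2} =
      ennreal (unit_ball_vol (real CARD('m)) * r ^ CARD('m) / sqrt (det (red_hess lam x n v)))"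
proof -
  let ?A = "Amat :: real ^ 'm ^ ('m option)"
  let ?K = "{1..n} <+> (UNIV :: 'm option set)"
  define a where "a = case_sum (\<lambda>\<tau>. (1 / (x \<tau> \<bullet> v)) *\<^sub>R (transpose ?A *v x \<tau>))
      (\<lambda>i. (sqrt lam / v $ i) *\<^sub>R row i ?A)"
  have fin: "finite ?K"
    by simp
  have sym: "transpose (red_hess lam x n v) = red_hess lam x n v"
    by (simp add: red_hess_def matrix_transpose_mul L_hess_symmetric[OF adm v] matrix_mul_assoc)
  have "row i ?A \<bullet> u = (?A *v u) $ i" for i u
    by (simp add: matrix_vector_mul_component row_def)
  then have quad: "u \<bullet> (red_hess lam x n v *v u) = (\<Sum>k\<in>?K. (a k \<bullet> u)\<^sup>2)" for u
    using lam
    by (simp add: red_hess_quadratic_form[OF adm v] sum.Plus a_def L_quad_def sum_distrib_left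
        power_mult_distrib power_divide dot_lmul_matrix)
  have pos: "0 < u \<bullet> (red_hess lam x n v *v u)" if "u \<noteq> 0" for u
    using that lam v by (simp add: red_hess_quadratic_form[OF adm v] L_quad_pos Amat_mult_eq_0_iff)
  show "0 < det (red_hess lam x n v)"
    by (rule ellipsoid_volume(1)[OF fin sym quad pos])
  show "0 \<le> r \<Longrightarrow> emeasure lborel {u. (u - c) \<bullet> (red_hess lam x n v *v (u - c)) < r\<^sup>2} =
      ennreal (unit_ball_vol (real CARD('m)) * r ^ CARD('m) / sqrt (det (red_hess lam x n v)))"
    by (rule ellipsoid_volume(2)[OF fin sym quad pos])
qed

text \<open>
  Since \<open>V(v)\<close> is half the log-determinant of the reduced Hessian, the logarithm of this volume is
  \<open>(d - 1) ln r - V(v)\<close> up to a constant that depends on the dimension only. This is how \<open>V\<close> enters the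
  comparison.
\<close>

lemma emeasure_dikin:
  fixes v :: "real ^ ('m::finite option)"
  assumes adm: "admissible x n" and lam: "0 < lam" and v: "v \<in> pos_orthant" "v \<in> aff_plane" and r: "0 \<le> r"
  shows "emeasure plane_lborel (dikin lam x n r v) =
    ennreal (area_factor TYPE('m) * unit_ball_vol (real CARD('m)) * r ^ CARD('m)
      / sqrt (det (red_hess lam x n v)))"
proof -
  define E where "E = {u. (u - plane_coord v) \<bullet> (red_hess lam x n v *v (u - plane_coord v)) < r\<^sup>2}"
  have "plane_param u - v = Amat *v (u - plane_coord v)" for u
    using plane_param_diff[of u "plane_coord v"] unfolding plane_param_coord[OF v(2)] .
  then have preimage: "plane_param -` dikin lam x n r v = E"
    unfolding dikin_def E_def
    by (simp only: vimage_def mem_Collect_eq plane_param_mem simp_thms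
        red_hess_quadratic_form[OF adm v(1)] L_hess_quadratic_form[OF adm v(1)])
  then have "E \<in> sets borel"
    using measurable_sets_borel[OF plane_param_measurable dikin_measurable[of lam x n r v]] by simp
  then have "emeasure plane_lborel (dikin lam x n r v) =
      ennreal (area_factor TYPE('m)) * emeasure lborel E"
    unfolding plane_lborel_eq by (simp add: emeasure_distr preimage emeasure_density_const)
  also have "emeasure lborel E =
      ennreal (unit_ball_vol (real CARD('m)) * r ^ CARD('m) / sqrt (det (red_hess lam x n v)))"
    unfolding E_def by (rule red_hess_ellipsoid(2)[OF adm lam v(1) r])
  finally show ?thesis
    using area_factor_pos[where 'm='m] by (simp add: ennreal_mult'[symmetric] mult_ac)
qed

section \<open>Entropy and the lower bound\<close>

text \<open>
  An integrable bound on one side controls the extended expectation even if the function itself is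
  not measurable or its expectation is infinite; so neither the entropy of the optimal density nor
  the expectation of \<open>L\<close> has to be shown finite.
\<close>

lemma ext_expectation_bounds:
  assumes h: "integrable M h"
  shows ext_expectation_le: "(AE w in M. f w \<le> ereal (h w)) \<Longrightarrow> ext_expectation M f \<le> ereal (integral\<^sup>L M h)"
    and ext_expectation_ge: "(AE w in M. ereal (h w) \<le> f w) \<Longrightarrow> ereal (integral\<^sup>L M h) \<le> ext_expectation M f"
proof -
  let ?p = "\<integral>\<^sup>+ w. ennreal (h w) \<partial>M" and ?m = "\<integral>\<^sup>+ w. ennreal (- h w) \<partial>M"
  have "?p \<noteq> \<infinity>" "?m \<noteq> \<infinity>"
    using h by (simp_all add: real_integrable_def)
  then have "enn2ereal ?p - enn2ereal ?m = ereal (enn2real ?p) - ereal (enn2real ?m)"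
    by (cases ?p; cases ?m) auto
  then have eq: "enn2ereal ?p - enn2ereal ?m = ereal (integral\<^sup>L M h)"
    by (simp add: real_lebesgue_integral_def[OF h])
  have mono: "enn2ereal (\<integral>\<^sup>+ w. e2ennreal (k w) \<partial>M) \<le> enn2ereal (\<integral>\<^sup>+ w. e2ennreal (k' w) \<partial>M)"
    if "AE w in M. k w \<le> k' w" for k k'
    unfolding less_eq_ennreal.rep_eq[symmetric]
    by (rule nn_integral_mono_AE) (use that in \<open>auto intro: e2ennreal_mono\<close>)
  show "ext_expectation M f \<le> ereal (integral\<^sup>L M h)" if "AE w in M. f w \<le> ereal (h w)"
  proof -
    have "AE w in M. ereal (- h w) \<le> - f w"
      using that by eventually_elim (metis ereal_minus_le_minus uminus_ereal.simps(1))
    from ereal_minus_mono[OF mono[OF that] mono[OF this]] show ?thesis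
      by (simp add: ext_expectation_def eq)
  qed
  show "ereal (integral\<^sup>L M h) \<le> ext_expectation M f" if "AE w in M. ereal (h w) \<le> f w"
  proof -
    have "AE w in M. - f w \<le> ereal (- h w)"
      using that by eventually_elim (metis ereal_minus_le_minus uminus_ereal.simps(1))
    from ereal_minus_mono[OF mono[OF that] mono[OF this]] show ?thesis
      by (simp add: ext_expectation_def eq)
  qed
qed

lemma sets_law [measurable_cong, simp]: "sets (law \<phi>) = sets borel"
  by (simp add: law_def)

lemma AE_law_iff:
  assumes "\<phi> \<in> borel_measurable borel"
  shows "(AE w in law \<phi>. P w) \<longleftrightarrow> (AE w in plane_lborel. 0 < \<phi> w \<longrightarrow> P w)"
  using assms unfolding law_def by (subst AE_density) auto

lemma Supp_AE_law:
  assumes "\<phi> \<in> Supp S"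
  shows "AE w in law \<phi>. w \<in> S \<and> 0 < \<phi> w"
proof -
  have "\<phi> \<in> borel_measurable borel" "AE w in plane_lborel. w \<notin> S \<longrightarrow> \<phi> w = 0"
    using assms by (auto simp: Supp_def prob_density_def)
  then show ?thesis
    by (auto simp: AE_law_iff)
qed

text \<open>
  The uniform density has the largest entropy on a set of volume \<open>W\<close>. With \<open>ln y \<le> y - 1\<close> at
  \<open>y = 1 / (W \<phi>(w))\<close>, the integrand \<open>- ln \<phi>\<close> is at most \<open>ln W - 1 + y\<close>, and the mean of \<open>y\<close> is at most
  \<open>1\<close>.
\<close>

lemma Ent_le_ln_measure:
  assumes \<phi>: "\<phi> \<in> Supp S" and S: "S \<in> sets borel"
    and W: "emeasure plane_lborel S = ennreal W" "0 < W"
  shows "Ent \<phi> \<le> ereal (ln W)"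
proof -
  have \<phi>_meas [measurable]: "\<phi> \<in> borel_measurable borel" and nonneg: "\<And>w. 0 \<le> \<phi> w"
    and prob: "prob_space (law \<phi>)"
    using \<phi> by (auto simp: Supp_def prob_density_def)
  interpret prob_space "law \<phi>"
    by (rule prob)
  note S [measurable]
  define k where "k w = indicator S w / (W * \<phi> w)" for w
  have k_meas [measurable]: "k \<in> borel_measurable borel"
    unfolding k_def by measurable
  have k_nonneg: "0 \<le> k w" for w
    using W(2) nonneg[of w] by (simp add: k_def)
  have "(\<integral>\<^sup>+ w. ennreal (k w) \<partial>law \<phi>) = (\<integral>\<^sup>+ w. ennreal (\<phi> w) * ennreal (k w) \<partial>plane_lborel)"
    unfolding law_def by (subst nn_integral_density) auto
  also have "\<dots> \<le> (\<integral>\<^sup>+ w. ennreal (1 / W) * indicator S w \<partial>plane_lborel)"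
  proof (rule nn_integral_mono)
    fix w
    show "ennreal (\<phi> w) * ennreal (k w) \<le> ennreal (1 / W) * indicator S w"
      using W(2) nonneg[of w]
      by (cases "\<phi> w = 0") (auto simp: k_def indicator_def simp flip: ennreal_mult)
  qed
  also have "\<dots> = ennreal (1 / W) * ennreal W"
    using S by (simp add: nn_integral_cmult_indicator W(1))
  also have "\<dots> = 1"
    using W(2) by (simp flip: ennreal_mult)
  finally have k_le: "(\<integral>\<^sup>+ w. ennreal (k w) \<partial>law \<phi>) \<le> 1" .
  have k_int: "integrable (law \<phi>) k"
    using k_nonneg k_le by (intro integrableI_nonneg) (auto simp: top.not_eq_extremum intro: le_less_trans)
  have "ennreal (expectation k) \<le> 1"
    using k_le nn_integral_eq_integral[OF k_int] k_nonneg by simp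
  then have k_exp: "expectation k \<le> 1"
    by simp
  have "AE w in law \<phi>. ereal (- ln (\<phi> w)) \<le> ereal (ln W - 1 + k w)"
    using Supp_AE_law[OF \<phi>]
  proof eventually_elim
    case (elim w)
    then have pos: "0 < W * \<phi> w"
      using W(2) by simp
    have "- ln (\<phi> w) = ln W + ln (1 / (W * \<phi> w))"
      using elim W(2) by (simp add: ln_div ln_mult)
    moreover have "ln (1 / (W * \<phi> w)) \<le> 1 / (W * \<phi> w) - 1"
      using pos by (intro ln_le_minus_one) simp
    ultimately show ?case
      using elim by (simp add: k_def)
  qed
  then have "Ent \<phi> \<le> ereal (expectation (\<lambda>w. ln W - 1 + k w))"
    unfolding Ent_def by (intro ext_expectation_le) (use k_int in auto)
  also have "expectation (\<lambda>w. ln W - 1 + k w) = ln W - 1 + expectation k"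
    using k_int by (simp add: prob_space)
  finally show ?thesis
    using k_exp by (simp add: order_trans)
qed

lemma mem_dikin_iff:
  assumes "admissible x n" "v \<in> pos_orthant"
  shows "w \<in> dikin lam x n r v \<longleftrightarrow> w \<in> aff_plane \<and> L_quad lam x n v (w - v) < r\<^sup>2"
  by (simp add: dikin_def L_hess_quadratic_form[OF assms])

text \<open>
  The trace is the mean of the quadratic form at \<open>w - E w\<close>; the bounded support makes all second moments
  finite.
\<close>

lemma trace_L_hess_Cov_nonneg:
  assumes adm: "admissible x n" and lam: "1 \<le> lam" and m: "mean_of \<phi> \<in> pos_orthant"
    and \<phi>: "\<phi> \<in> Supp (dikin lam x n (1 / 4) (mean_of \<phi>))"
  shows "0 \<le> trace (L_hess lam x n (mean_of \<phi>) ** Cov \<phi>)"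
proof -
  interpret prob_space "law \<phi>"
    using \<phi> by (simp add: Supp_def prob_density_def)
  define m where "m = mean_of \<phi>"
  define H where "H = L_hess lam x n m"
  have comp: "AE w in law \<phi>. \<forall>i. \<bar>(w - m) $ i\<bar> \<le> m $ i / 2"
    using Supp_AE_law[OF \<phi>]
  proof eventually_elim
    case (elim w)
    then have "L_quad lam x n m (w - m) \<le> 1 / 4"
      using mem_dikin_iff[OF adm m] by (simp add: m_def power2_eq_square)
    then show ?case
      unfolding m_def using L_quad_small_component[OF lam m] by blast
  qed
  have int: "integrable (law \<phi>) (\<lambda>w. (w $ i - m $ i) * (w $ j - m $ j))" for i j
  proof (rule integrable_const_bound)
    show "AE w in law \<phi>. norm ((w $ i - m $ i) * (w $ j - m $ j)) \<le> m $ i / 2 * (m $ j / 2)"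
      using comp
    proof eventually_elim
      case (elim w)
      then have "\<bar>w $ i - m $ i\<bar> \<le> m $ i / 2" "\<bar>w $ j - m $ j\<bar> \<le> m $ j / 2"
        by simp_all
      moreover from this(1) have "0 \<le> m $ i / 2"
        by linarith
      ultimately show ?case
        unfolding real_norm_def abs_mult by (intro mult_mono) auto
    qed
  qed measurable
  have "trace (H ** Cov \<phi>) = (\<Sum>i\<in>UNIV. \<Sum>k\<in>UNIV. H $ i $ k * Cov \<phi> $ k $ i)"
    by (simp add: trace_def matrix_matrix_mult_def)
  also have "\<dots> = (\<Sum>i\<in>UNIV. \<Sum>k\<in>UNIV. expectation (\<lambda>w. H $ i $ k * ((w $ k - m $ k) * (w $ i - m $ i))))"
    by (simp add: Cov_def m_def)
  also have "\<dots> = expectation (\<lambda>w. \<Sum>i\<in>UNIV. \<Sum>k\<in>UNIV. H $ i $ k * ((w $ k - m $ k) * (w $ i - m $ i)))"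
    using int by (subst Bochner_Integration.integral_sum, simp)
      (intro sum.cong refl Bochner_Integration.integral_sum[symmetric], simp)
  also have "\<dots> = expectation (\<lambda>w. (w - m) \<bullet> (H *v (w - m)))"
    by (intro Bochner_Integration.integral_cong refl)
      (simp add: inner_vec_def matrix_vector_mult_def sum_distrib_left mult_ac)
  also have "\<dots> \<ge> 0"
    using lam m L_quad_nonneg[of lam x n m]
    by (intro Bochner_Integration.integral_nonneg)
      (simp add: H_def m_def L_hess_quadratic_form[OF adm])
  finally show ?thesis
    by (simp add: H_def m_def)
qed

text \<open>
  The lower half of the comparison: the trace term is dropped and the entropy is replaced by its maximum
  over densities on the Dikin ellipsoid.
\<close>

lemma Fbar_obj_ge:
  assumes adm: "admissible x n" and lam: "1 \<le> lam" and \<mu>: "0 \<le> \<mu>"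
    and m: "mean_of \<phi> \<in> pos_orthant"
    and \<phi>: "\<phi> \<in> Supp (dikin lam x n (1 / 4) (mean_of \<phi>))"
    and W: "emeasure plane_lborel (dikin lam x n (1 / 4) (mean_of \<phi>)) = ennreal W" "0 < W"
  shows "ereal (L_fin lam x n (mean_of \<phi>) - \<mu> * ln W) \<le> Fbar_obj lam \<mu> x n \<phi>"
proof -
  have "ereal \<mu> * Ent \<phi> \<le> ereal \<mu> * ereal (ln W)"
    using Ent_le_ln_measure[OF \<phi> dikin_measurable W] \<mu> by (intro ereal_mult_left_mono) auto
  moreover have "ereal (L_fin lam x n (mean_of \<phi>)) \<le> L_fun lam x n (mean_of \<phi>)
      + ereal (4 / 5 * trace (L_hess lam x n (mean_of \<phi>) ** Cov \<phi>))"
    using trace_L_hess_Cov_nonneg[OF adm lam m \<phi>] m by (simp add: L_fun_def)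
  ultimately show ?thesis
    unfolding Fbar_obj_def by (metis ereal_minus_mono ereal_minus(1) times_ereal.simps(1))
qed

lemma convex_std_simplex: "convex std_simplex"
  unfolding std_simplex_def convex_def
  by (auto simp: sum.distrib simp flip: sum_distrib_left)

lemma simplex_barycenter:
  "(\<chi> i. 1 / real CARD('n)) \<in> (std_simplex :: (real ^ 'n::finite) set)"
  "(\<chi> i. 1 / real CARD('n)) \<in> (pos_orthant :: (real ^ 'n::finite) set)"
  by (simp_all add: std_simplex_def pos_orthant_def)

lemma rel_interior_std_simplex_pos:
  assumes "w \<in> rel_interior (std_simplex :: (real ^ 'n::finite) set)"
  shows "w \<in> pos_orthant"
proof -
  let ?c = "(\<chi> i. 1 / real CARD('n)) :: real ^ 'n"
  have "w \<in> std_simplex"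
    using assms rel_interior_subset by blast
  \<comment> \<open>the segment from the barycenter through \<open>w\<close> stays in the simplex a little beyond \<open>w\<close>;
      a vanishing coordinate of \<open>w\<close> would become negative there\<close>
  obtain e where e: "1 < e" "(1 - e) *\<^sub>R ?c + e *\<^sub>R w \<in> std_simplex"
    using assms convex_rel_interior_iff[OF convex_std_simplex] simplex_barycenter(1) by blast
  have "0 < w $ i" for i
  proof (rule ccontr)
    assume "\<not> 0 < w $ i"
    then have "e * w $ i \<le> 0"
      using e(1) by (simp add: mult_nonneg_nonpos)
    moreover have "(1 - e) * ?c $ i < 0"
      using e(1) by (simp add: divide_neg_pos)
    moreover have "0 \<le> ((1 - e) *\<^sub>R ?c + e *\<^sub>R w) $ i"
      using e(2) by (simp only: std_simplex_def mem_Collect_eq)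
    ultimately show False
      by simp
  qed
  then show ?thesis
    by (simp add: pos_orthant_def)
qed

text \<open>
  The barycenter has a finite value, so the minimizer cannot lie where \<open>P\<close> is infinite.
\<close>

lemma P_fun_minimizer:
  fixes x :: "nat \<Rightarrow> real ^ ('m::finite option)"
  assumes min: "is_arg_min (P_fun lam \<mu> x n) (\<lambda>w. w \<in> std_simplex) v" and \<mu>: "0 < \<mu>"
  shows "v \<in> std_simplex" "v \<in> pos_orthant"
    and "w \<in> std_simplex \<Longrightarrow> w \<in> pos_orthant \<Longrightarrow>
      L_fin lam x n v + \<mu> * V_fin lam x n v \<le> L_fin lam x n w + \<mu> * V_fin lam x n w"
proof -
  have P: "P_fun lam \<mu> x n w =
      (if w \<in> pos_orthant then ereal (L_fin lam x n w + \<mu> * V_fin lam x n w) else \<infinity>)" for w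
    using \<mu> by (simp add: P_fun_def L_fun_def V_fun_def)
  have le: "P_fun lam \<mu> x n v \<le> P_fun lam \<mu> x n w" if "w \<in> std_simplex" for w
    using min that by (auto simp: is_arg_min_def not_less)
  show "v \<in> std_simplex"
    using min by (simp add: is_arg_min_def)
  show v: "v \<in> pos_orthant"
    using le[OF simplex_barycenter(1)] simplex_barycenter(2)[where 'n="'m option"] by (auto simp: P split: if_splits)
  show "L_fin lam x n v + \<mu> * V_fin lam x n v \<le> L_fin lam x n w + \<mu> * V_fin lam x n w"
    if "w \<in> std_simplex" "w \<in> pos_orthant"
    using le[OF that(1)] that(2) v by (simp add: P)
qed

section \<open>The Gaussian density on the hyperplane\<close>

lemma matrix_inv_eqI:
  assumes "A ** B = mat 1" "B ** A = mat 1"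
  shows "matrix_inv A = B"
proof -
  have "A ** matrix_inv A = mat 1 \<and> matrix_inv A ** A = mat 1"
    unfolding matrix_inv_def by (rule someI[of _ B]) (simp add: assms)
  then show ?thesis
    by (metis assms(2) matrix_mul_assoc matrix_mul_lid matrix_mul_rid)
qed

lemma matrix_inv_scaled_inv:
  fixes R :: "real ^ 'm::finite ^ 'm"
  assumes "det R \<noteq> 0" "c \<noteq> 0"
  shows "matrix_inv (c *\<^sub>R matrix_inv R) = (1 / c) *\<^sub>R R"
proof -
  obtain R' where R': "R ** R' = mat 1" "R' ** R = mat 1"
    using assms(1) invertible_det_nz[of R] unfolding invertible_def by auto
  have "(c *\<^sub>R R') ** ((1 / c) *\<^sub>R R) = R' ** R" "((1 / c) *\<^sub>R R) ** (c *\<^sub>R R') = R ** R'"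
    using assms(2) by (simp_all add: matrix_matrix_mult_def vec_eq_iff)
  then show ?thesis
    unfolding matrix_inv_eqI[OF R'] by (intro matrix_inv_eqI) (simp_all add: R')
qed

text \<open>
  Taking coordinates turns the equality of laws into an equality of densities on \<open>\<real>\<^sup>d\<^sup>-\<^sup>1\<close>. Only the shape
  of the Gaussian is kept, its normalization is left as an unknown constant \<open>K\<close>, because truncation renormalizes
  anyway.
\<close>

lemma degenerate_normal_density:
  fixes v :: "real ^ ('m::finite option)"
  assumes g: "prob_density g" and law: "law g = degenerate_normal v Amat S" and v: "v \<in> aff_plane"
  shows "\<exists>K>0. AE w in plane_lborel. g w =
    K * exp (- ((plane_coord w - plane_coord v) \<bullet> (matrix_inv S *v (plane_coord w - plane_coord v))) / 2)"
proof -
  define a where "a = area_factor TYPE('m)"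
  have a: "0 < a"
    by (simp add: a_def area_factor_pos)
  define c where "c = plane_coord v"
  define q where "q u = (u - c) \<bullet> (matrix_inv S *v (u - c))" for u
  define C where "C = sqrt ((2 * pi) ^ CARD('m) * det S)"
  have g_meas [measurable]: "g \<in> borel_measurable borel" and nonneg: "\<And>w. 0 \<le> g w"
    and prob: "prob_space (law g)"
    using g by (auto simp: prob_density_def)
  have "continuous_on UNIV (\<lambda>u. matrix_inv S *v (u - c))"
    by (intro linear_continuous_on_compose[OF _ matrix_vector_mul_linear] continuous_intros)
  then have q_meas [measurable]: "q \<in> borel_measurable borel"
    unfolding q_def by (intro borel_measurable_continuous_onI continuous_intros)
  have normal: "mv_normal_density 0 S (u - c) = exp (- q u / 2) / C" for u
    by (simp add: mv_normal_density_def q_def C_def)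
  have normal': "mv_normal_density 0 S u = exp (- q (u + c) / 2) / C" for u
    using normal[of "u + c"] by simp
  have normal_meas [measurable]: "mv_normal_density 0 S \<in> borel_measurable borel"
    unfolding normal' by measurable

  have "law g = density (distr (density lborel (\<lambda>_. ennreal a)) borel plane_param) (\<lambda>w. ennreal (g w))"
    unfolding law_def plane_lborel_eq a_def ..
  also have "\<dots> = distr (density lborel (\<lambda>u. ennreal (a * g (plane_param u)))) borel plane_param"
    using a by (subst density_distr) (simp_all add: density_density_eq ennreal_mult'[symmetric])
  finally have "distr (law g) borel plane_coord = density lborel (\<lambda>u. ennreal (a * g (plane_param u)))"
    by (simp add: distr_distr comp_def plane_coord_param distr_id2)
  moreover have "distr (law g) borel plane_coord = density lborel (\<lambda>u. ennreal (mv_normal_density 0 S (u - c)))"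
  proof -
    have "v + Amat *v u = plane_param (u + c)" for u
      using plane_param_diff[of "u + c" c] by (simp add: c_def plane_param_coord[OF v] diff_eq_eq add.commute)
    then have "law g = distr (density lborel (\<lambda>u. ennreal (mv_normal_density 0 S u))) borel (\<lambda>u. plane_param (u + c))"
      by (simp add: law degenerate_normal_def)
    then have "distr (law g) borel plane_coord =
        distr (density lborel (\<lambda>u. ennreal (mv_normal_density 0 S (u + c - c)))) borel (\<lambda>u. u + c)"
      by (simp add: distr_distr comp_def plane_coord_param)
    also have "\<dots> = density (distr lborel borel (\<lambda>u. u + c)) (\<lambda>u. ennreal (mv_normal_density 0 S (u - c)))"
      by (subst density_distr) simp_all
    also have "distr lborel borel (\<lambda>u. u + c) = lborel"
      using lborel_distr_plus[of c] by (simp only: add.commute[of _ c])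
    finally show ?thesis .
  qed
  ultimately have "AE u in lborel. ennreal (a * g (plane_param u)) = ennreal (mv_normal_density 0 S (u - c))"
    by (intro sigma_finite_measure.density_unique[OF sigma_finite_lborel]) simp_all
  then have "AE u in lborel. ennreal (a * g (plane_param u)) = ennreal (exp (- q u / 2) / C)"
    by (simp add: normal)
  then have coord: "AE w in plane_lborel. ennreal (a * g w) = ennreal (exp (- q (plane_coord w) / 2) / C)"
    by (intro AE_plane_lborelI) (simp_all add: plane_coord_param)
  \<comment> \<open>division by zero gives \<open>0\<close> and the root of a negative number is negative, so without a positive
      determinant the density would be nonpositive everywhere and have total mass zero\<close>
  have "0 < C"
  proof (rule ccontr)
    assume "\<not> 0 < C"
    then have nonpos: "exp y / C \<le> 0" for y
      by (simp add: divide_le_0_iff)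
    have "AE w in plane_lborel. g w = 0"
      using coord
    proof eventually_elim
      case (elim w)
      then have "a * g w \<le> 0"
        using nonpos by (simp add: ennreal_neg ennreal_eq_0_iff)
      then show ?case
        using a nonneg[of w] by (simp add: mult_le_0_iff)
    qed
    then have "emeasure (law g) UNIV = 0"
      unfolding law_def
      by (auto simp: emeasure_density nn_integral_0_iff_AE elim: eventually_mono)
    then show False
      using prob_space.emeasure_space_1[OF prob] by (simp add: law_def)
  qed
  have "AE w in plane_lborel. g w = 1 / (a * C) * exp (- q (plane_coord w) / 2)"
    using coord
  proof eventually_elim
    case (elim w)
    then have "a * g w = exp (- q (plane_coord w) / 2) / C"
      using a nonneg[of w] \<open>0 < C\<close> by (simp add: ennreal_inj)
    then show ?case
      using a \<open>0 < C\<close> by (simp add: field_simps)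
  qed
  then show ?thesis
    using a \<open>0 < C\<close> unfolding q_def c_def by (intro exI[of _ "1 / (a * C)"]) simp
qed

text \<open>
  With covariance \<open>1/16\<close> times the inverse reduced Hessian, the exponent is \<open>- 16/2\<close> times the local
  quadratic form.
\<close>

lemma dikin_gaussian_density:
  fixes v :: "real ^ ('m::finite option)"
  assumes adm: "admissible x n" and lam: "0 < lam" and v: "v \<in> pos_orthant" "v \<in> aff_plane"
    and g: "prob_density g"
      "law g = degenerate_normal v Amat ((1 / 16) *\<^sub>R matrix_inv (red_hess lam x n v))"
  shows "\<exists>K>0. AE w in plane_lborel. g w = K * exp (- 8 * L_quad lam x n v (w - v))"
proof -
  let ?R = "red_hess lam x n v"
  let ?z = "\<lambda>w. plane_coord w - plane_coord v"
  have "det ?R \<noteq> 0"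
    using red_hess_ellipsoid(1)[OF adm lam v(1)] by simp
  then have inv: "matrix_inv ((1 / 16) *\<^sub>R matrix_inv ?R) = 16 *\<^sub>R ?R"
    by (simp add: matrix_inv_scaled_inv)
  obtain K where K: "0 < K" "AE w in plane_lborel. g w = K * exp (- (?z w \<bullet> ((16 *\<^sub>R ?R) *v ?z w)) / 2)"
    using degenerate_normal_density[OF g v(2)] unfolding inv by auto
  have "?z w \<bullet> ((16 *\<^sub>R ?R) *v ?z w) = 16 * L_quad lam x n v (w - v)" if "w \<in> aff_plane" for w
    using plane_param_diff[of "plane_coord w" "plane_coord v"]
    by (simp add: plane_param_coord that v(2) red_hess_quadratic_form[OF adm v(1)]
        scaleR_matrix_vector_assoc[symmetric])
  moreover have "AE w in plane_lborel. w \<in> (aff_plane :: (real ^ ('m option)) set)"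
    by (rule AE_plane_lborel_mem)
  ultimately have "AE w in plane_lborel. g w = K * exp (- 8 * L_quad lam x n v (w - v))"
    using K(2) by (auto elim!: eventually_elim2)
  then show ?thesis
    using K(1) by auto
qed

section \<open>The truncated Gaussian\<close>

lemma L_lin_uminus: "L_lin lam x n v (- z) = - L_lin lam x n v z"
  by (simp add: L_lin_def sum_negf)

lemma L_quad_uminus: "L_quad lam x n v (- z) = L_quad lam x n v z"
  by (simp add: L_quad_def)

lemma L_lin_measurable [measurable]: "(\<lambda>w. L_lin lam x n v (w - c)) \<in> borel_measurable borel"
  unfolding L_lin_def divide_inverse
  by (intro borel_measurable_continuous_onI continuous_intros)

lemma L_quad_measurable [measurable]: "(\<lambda>w. L_quad lam x n v (w - c)) \<in> borel_measurable borel"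
  unfolding L_quad_def divide_inverse
  by (intro borel_measurable_continuous_onI continuous_intros)

text \<open>
  Boundedness on the ellipsoid, for integrability; the value of the bound does not matter.
\<close>

lemma abs_L_lin_le:
  fixes v z :: "real ^ 'n::finite"
  assumes lam: "1 \<le> lam" and v: "v \<in> pos_orthant" and small: "L_quad lam x n v z \<le> 1 / 4"
  shows "\<bar>L_lin lam x n v z\<bar> \<le> (\<Sum>\<tau>=1..n. 1 / 2) + lam * (\<Sum>i\<in>(UNIV :: 'n::finite set). 1 / 2)"
proof -
  have "\<bar>\<Sum>\<tau>=1..n. (x \<tau> \<bullet> z) / (x \<tau> \<bullet> v)\<bar> \<le> (\<Sum>\<tau>=1..n. 1 / 2)"
    by (rule order_trans[OF sum_abs], rule sum_mono, rule L_quad_small(1)[OF assms])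
  moreover have "\<bar>\<Sum>i\<in>UNIV. z $ i / v $ i\<bar> \<le> (\<Sum>i\<in>(UNIV :: 'n set). 1 / 2)"
    by (rule order_trans[OF sum_abs], rule sum_mono, rule L_quad_small(2)[OF assms])
  then have "\<bar>lam * (\<Sum>i\<in>UNIV. z $ i / v $ i)\<bar> \<le> lam * (\<Sum>i\<in>(UNIV :: 'n set). 1 / 2)"
    unfolding abs_mult using lam by (intro mult_mono) auto
  ultimately show ?thesis
    unfolding L_lin_def by linarith
qed

text \<open>
  The upper half of the comparison. On the ellipsoid \<open>q < 1/4\<close>, so the Gaussian factor \<open>exp (- 8 q)\<close> exceeds
  \<open>exp (- 2)\<close> and the peak of the truncated density is at most \<open>exp 2 / W\<close>. Pointwise, up to the linear
  term, \<open>L + \<mu> ln \<phi>\<close> is at most \<open>L(v) + \<mu> (2 - ln W) + (4/5 - 8 \<mu>) q\<close>; the bound \<open>\<mu> \<ge> 1/10\<close> is exactly what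
  makes the last summand nonpositive.
\<close>

lemma F_obj_truncated_gaussian_le:
  fixes v :: "real ^ ('m::finite option)"
  assumes adm: "admissible x n" and lam: "1 \<le> lam" and \<mu>: "1 / 10 \<le> \<mu>"
    and v: "v \<in> pos_orthant" "v \<in> aff_plane"
    and g: "prob_density g"
    and K: "0 < K" "AE w in plane_lborel. g w = K * exp (- 8 * L_quad lam x n v (w - v))"
    and W: "emeasure plane_lborel (dikin lam x n (1 / 2) v) = ennreal W" "0 < W"
  shows "F_obj lam \<mu> x n (truncate_density (dikin lam x n (1 / 2) v) g)
    \<le> ereal (L_fin lam x n v + \<mu> * (2 - ln W))"
proof -
  define E where "E = dikin lam x n (1 / 2) v"
  define q where "q w = L_quad lam x n v (w - v)" for w
  define l where "l w = L_lin lam x n v (w - v)" for w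
  define Z where "Z = measure (law g) E"
  define \<phi> where "\<phi> = truncate_density E g"
  define f where "f w = indicator E w * (K / Z * exp (- 8 * q w))" for w
  have E_meas [measurable]: "E \<in> sets borel"
    by (simp add: E_def)
  have q_meas [measurable]: "q \<in> borel_measurable borel" and l_meas [measurable]: "l \<in> borel_measurable borel"
    by (simp_all add: q_def[abs_def] l_def[abs_def])
  have g_meas [measurable]: "g \<in> borel_measurable borel" and g_nonneg: "\<And>w. 0 \<le> g w"
    and g_prob: "prob_space (law g)"
    using g by (auto simp: prob_density_def)
  interpret g: prob_space "law g"
    by (rule g_prob)
  have E: "w \<in> E \<longleftrightarrow> w \<in> aff_plane \<and> q w < 1 / 4" for w
    unfolding E_def mem_dikin_iff[OF adm v(1)] q_def by (simp add: power2_eq_square)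
  have q_nonneg: "0 \<le> q w" for w
    unfolding q_def using lam by (intro L_quad_nonneg) simp
  have emeasure_E: "emeasure (law g) E = (\<integral>\<^sup>+ w. ennreal (g w) * indicator E w \<partial>plane_lborel)"
    unfolding law_def by (subst emeasure_density) simp_all
  have "ennreal (K * exp (- 2) * W) = (\<integral>\<^sup>+ w. ennreal (K * exp (- 2)) * indicator E w \<partial>plane_lborel)"
    using K(1) W by (simp add: nn_integral_cmult_indicator E_def[symmetric] ennreal_mult)
  also have "\<dots> \<le> emeasure (law g) E"
    unfolding emeasure_E
  proof (rule nn_integral_mono_AE)
    show "AE w in plane_lborel. ennreal (K * exp (- 2)) * indicator E w \<le> ennreal (g w) * indicator E w"
      using K(2)
    proof eventually_elim
      case (elim w)
      then show ?case
        using K(1) E[of w] by (auto simp: indicator_def q_def intro!: ennreal_leI)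
    qed
  qed
  finally have Z_ge: "K * exp (- 2) * W \<le> Z"
    unfolding g.emeasure_eq_measure Z_def by simp
  moreover have "0 < K * exp (- 2) * W"
    using K(1) W(2) by simp
  ultimately have Z: "0 < Z"
    by linarith
  have peak: "ln (K / Z) \<le> 2 - ln W"
  proof -
    have "ln (K * exp (- 2) * W) \<le> ln Z"
      using Z_ge \<open>0 < K * exp (- 2) * W\<close> by simp
    then show ?thesis
      using K(1) W(2) Z by (simp add: ln_mult ln_div)
  qed
  have \<phi>_eq: "\<phi> w = indicator E w * g w / Z" for w
    by (simp add: \<phi>_def truncate_density_def Z_def)
  have \<phi>_meas [measurable]: "\<phi> \<in> borel_measurable borel"
    unfolding \<phi>_eq by measurable
  have f_meas [measurable]: "f \<in> borel_measurable borel"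
    unfolding f_def by measurable
  have f_nonneg: "0 \<le> f w" for w
    using K(1) Z by (simp add: f_def)
  have \<phi>_f: "AE w in plane_lborel. \<phi> w = f w"
    using K(2) by eventually_elim (simp add: \<phi>_eq f_def q_def)
  have law_f: "law \<phi> = density plane_lborel (\<lambda>w. ennreal (f w))"
    unfolding law_def by (rule density_cong) (use \<phi>_f in auto)
  have "emeasure (law \<phi>) (space (law \<phi>)) = (\<integral>\<^sup>+ w. ennreal (1 / Z) * (ennreal (g w) * indicator E w) \<partial>plane_lborel)"
    unfolding law_def using Z g_nonneg
    by (subst emeasure_density)
      (auto intro!: nn_integral_cong simp: \<phi>_eq indicator_def simp flip: ennreal_mult)
  also have "\<dots> = ennreal (1 / Z) * emeasure (law g) E"
    unfolding emeasure_E by (rule nn_integral_cmult) simp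
  also have "\<dots> = 1"
    using Z by (simp add: g.emeasure_eq_measure flip: Z_def ennreal_mult)
  finally interpret prob_space "law \<phi>"
    by (rule prob_spaceI)

  have support: "AE w in law \<phi>. w \<in> E \<and> \<phi> w = K / Z * exp (- 8 * q w)"
    unfolding AE_law_iff[OF \<phi>_meas] using \<phi>_f
    by eventually_elim (auto simp: f_def indicator_def split: if_splits)
  have small: "L_quad lam x n v (w - v) \<le> 1 / 4" if "w \<in> E" for w
    using that E[of w] by (simp add: q_def)
  have q_int: "integrable (law \<phi>) q"
  proof (rule integrable_const_bound)
    show "AE w in law \<phi>. norm (q w) \<le> 1 / 4"
      using support by eventually_elim (use q_nonneg E in \<open>auto intro: less_imp_le\<close>)
  qed measurable
  have l_int: "integrable (law \<phi>) l"
  proof (rule integrable_const_bound)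
    show "AE w in law \<phi>. norm (l w) \<le> (\<Sum>\<tau>=1..n. 1 / 2) + lam * (\<Sum>i\<in>(UNIV :: 'm option set). 1 / 2)"
      using support
      by eventually_elim (use abs_L_lin_le[OF lam v(1) small] in \<open>simp add: l_def\<close>)
  qed measurable

  have l_zero: "expectation l = 0"
  proof -
    have reflect: "l (2 *\<^sub>R v - w) = - l w" "q (2 *\<^sub>R v - w) = q w" for w
    proof -
      have "2 *\<^sub>R v - w - v = - (w - v)"
        by (simp add: scaleR_2)
      then show "l (2 *\<^sub>R v - w) = - l w" "q (2 *\<^sub>R v - w) = q w"
        unfolding l_def q_def by (simp_all only: L_lin_uminus L_quad_uminus)
    qed
    have "2 *\<^sub>R v - w \<in> aff_plane \<longleftrightarrow> w \<in> aff_plane" for w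
      using v(2) by (auto simp: aff_plane_def sum_subtractf simp flip: sum_distrib_left)
    then have f_reflect: "f (2 *\<^sub>R v - w) = f w" for w
      unfolding f_def by (simp add: indicator_def E reflect)
    have "expectation l = (\<integral> w. f w * l w \<partial>plane_lborel)"
      unfolding law_f using f_nonneg by (subst integral_density) auto
    also have "\<dots> = (\<integral> w. f w * l w \<partial>distr plane_lborel borel (\<lambda>w. 2 *\<^sub>R v - w))"
      by (simp only: plane_lborel_reflect[OF v(2)])
    also have "\<dots> = (\<integral> w. - (f w * l w) \<partial>plane_lborel)"
      by (subst integral_distr) (simp_all add: f_reflect reflect)
    also have "\<dots> = - (\<integral> w. f w * l w \<partial>plane_lborel)"
      by simp
    also have "\<dots> = - expectation l"
      unfolding law_f using f_nonneg by (subst integral_density) auto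
    finally show ?thesis by simp
  qed

  have "AE w in law \<phi>. L_fun lam x n w \<le> ereal (L_fin lam x n v + l w + 4 / 5 * q w)"
    using support
  proof eventually_elim
    case (elim w)
    then show ?case
      using L_fin_upper[OF adm lam v(1) small[of w]] by (simp add: L_fun_def l_def q_def)
  qed
  then have "ext_expectation (law \<phi>) (L_fun lam x n) \<le>
      ereal (expectation (\<lambda>w. L_fin lam x n v + l w + 4 / 5 * q w))"
    by (intro ext_expectation_le) (use l_int q_int in auto)
  also have "expectation (\<lambda>w. L_fin lam x n v + l w + 4 / 5 * q w) = L_fin lam x n v + 4 / 5 * expectation q"
    using l_int q_int by (simp add: l_zero prob_space)
  finally have L_le: "ext_expectation (law \<phi>) (L_fun lam x n) \<le> ereal (L_fin lam x n v + 4 / 5 * expectation q)" .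

  have "AE w in law \<phi>. ereal (8 * q w - ln (K / Z)) \<le> ereal (- ln (\<phi> w))"
    using support
  proof eventually_elim
    case (elim w)
    have "ln (K / Z * exp (- 8 * q w)) = ln (K / Z) - 8 * q w"
      using K(1) Z ln_mult_pos[of "K / Z" "exp (- 8 * q w)"] by simp
    then show ?case
      using elim by simp
  qed
  then have "ereal (expectation (\<lambda>w. 8 * q w - ln (K / Z))) \<le> Ent \<phi>"
    unfolding Ent_def by (intro ext_expectation_ge) (use q_int in auto)
  also have "expectation (\<lambda>w. 8 * q w - ln (K / Z)) = 8 * expectation q - ln (K / Z)"
    using q_int by (simp add: prob_space)
  finally have "ereal \<mu> * ereal (8 * expectation q - ln (K / Z)) \<le> ereal \<mu> * Ent \<phi>"
    using \<mu> by (intro ereal_mult_left_mono) auto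
  then have "F_obj lam \<mu> x n \<phi> \<le>
      ereal (L_fin lam x n v + 4 / 5 * expectation q) - ereal \<mu> * ereal (8 * expectation q - ln (K / Z))"
    unfolding F_obj_def using L_le by (intro ereal_minus_mono)
  also have "\<dots> = ereal (L_fin lam x n v + 4 / 5 * expectation q - \<mu> * (8 * expectation q - ln (K / Z)))"
    by simp
  also have "\<dots> \<le> ereal (L_fin lam x n v + \<mu> * (2 - ln W))"
  proof -
    have "0 \<le> expectation q"
      using q_nonneg by (simp add: Bochner_Integration.integral_nonneg)
    then have "4 / 5 * expectation q \<le> 8 * \<mu> * expectation q"
      using \<mu> by (intro mult_right_mono) auto
    moreover have "\<mu> * ln (K / Z) \<le> \<mu> * (2 - ln W)"
      using peak \<mu> by (intro mult_left_mono) auto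
    ultimately show ?thesis
      by (simp add: algebra_simps)
  qed
  finally show ?thesis
    by (simp add: \<phi>_def E_def)
qed

section \<open>Comparison of the two objectives\<close>

theorem proposition2p3:
  fixes T t :: nat
    and x :: "nat \<Rightarrow> real ^ ('m::finite option)"
    and lam \<mu> :: real
    and phibar g :: "real ^ ('m option) \<Rightarrow> real"
    and w\<^sub>t :: "real ^ ('m option)"
    and \<Sigma> :: "real ^ 'm ^ 'm"
  assumes "T \<ge> 1" and "t \<in> {1..T}"
    and "\<And>\<tau>. \<tau> \<in> {1..T} \<Longrightarrow> (\<forall>i. 0 \<le> x \<tau> $ i) \<and> x \<tau> \<noteq> 0"
    and "lam \<ge> 1" and "\<mu> > 0.1"
    and phibar_optimal:
      "is_arg_min (Fbar_obj lam \<mu> x (t - 1)) (\<lambda>\<phi>. \<phi> \<in> feasible lam x (t - 1)) phibar"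
    and wt_minimizer:
      "is_arg_min (P_fun lam \<mu> x (t - 1)) (\<lambda>w. w \<in> std_simplex) w\<^sub>t"
    and Sigma_eq: "\<Sigma> = (1 / 16) *\<^sub>R matrix_inv (red_hess lam x (t - 1) w\<^sub>t)"
    and g_gaussian_density: "prob_density g" "law g = degenerate_normal w\<^sub>t Amat \<Sigma>"
  shows "F_obj lam \<mu> x (t - 1) (truncate_density (dikin lam x (t - 1) (1 / 2) w\<^sub>t) g)
    \<le> Fbar_obj lam \<mu> x (t - 1) phibar
       + ereal (0.5 * \<mu> * (real CARD('m option) - 1) * ln (350 * real CARD('m option)) + 0.01 * \<mu>)"
proof -
  let ?n = "t - 1"
  let ?d = "real CARD('m)"
  have adm: "admissible x ?n"
    using assms(2,3) by (auto simp: admissible_def)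
  have lam: "1 \<le> lam" "0 < lam" and \<mu>: "1 / 10 \<le> \<mu>" "0 < \<mu>"
    using assms(4,5) by auto
  have simplex_plane: "w \<in> aff_plane" if "w \<in> std_simplex" for w :: "real ^ 'm option"
    using that by (simp add: std_simplex_def aff_plane_def)
  define m where "m = mean_of phibar"
  have feas: "m \<in> rel_interior std_simplex" "phibar \<in> Supp (dikin lam x ?n (1 / 4) m)"
    using phibar_optimal by (auto simp: is_arg_min_def feasible_def m_def)
  have m: "m \<in> std_simplex" "m \<in> pos_orthant"
    using feas(1) rel_interior_subset rel_interior_std_simplex_pos by blast+
  note wt = P_fun_minimizer[OF wt_minimizer \<mu>(2)]
  define c where "c = area_factor TYPE('m) * unit_ball_vol ?d"
  have c: "0 < c"
    by (simp add: c_def area_factor_pos)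
  define W where "W r w = c * r ^ CARD('m) / sqrt (det (red_hess lam x ?n w))" for r w
  have dikin_W: "emeasure plane_lborel (dikin lam x ?n r w) = ennreal (W r w)" "0 < W r w"
    "ln (W r w) = ln c + ?d * ln r - V_fin lam x ?n w"
    if "w \<in> std_simplex" "w \<in> pos_orthant" "0 < r" for r w
  proof -
    have det: "0 < det (red_hess lam x ?n w)"
      by (rule red_hess_ellipsoid(1)[OF adm lam(2) that(2)])
    show "emeasure plane_lborel (dikin lam x ?n r w) = ennreal (W r w)"
      unfolding W_def c_def using that by (intro emeasure_dikin[OF adm lam(2)] simplex_plane) auto
    show "0 < W r w"
      using det that(3) c by (simp add: W_def)
    show "ln (W r w) = ln c + ?d * ln r - V_fin lam x ?n w"
      using det that(3) c by (simp add: W_def ln_mult ln_div ln_sqrt ln_realpow V_fin_def)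
  qed

  obtain K where K: "0 < K" "AE w in plane_lborel. g w = K * exp (- 8 * L_quad lam x ?n w\<^sub>t (w - w\<^sub>t))"
    using dikin_gaussian_density[OF adm lam(2) wt(2) simplex_plane[OF wt(1)]] g_gaussian_density
    unfolding Sigma_eq by blast
  have "F_obj lam \<mu> x ?n (truncate_density (dikin lam x ?n (1 / 2) w\<^sub>t) g)
      \<le> ereal (L_fin lam x ?n w\<^sub>t + \<mu> * (2 - ln (W (1 / 2) w\<^sub>t)))"
    using F_obj_truncated_gaussian_le[OF adm lam(1) \<mu>(1) wt(2) simplex_plane[OF wt(1)] g_gaussian_density(1) K]
      dikin_W(1,2)[OF wt(1,2), of "1 / 2"] by simp
  also have "\<dots> \<le> ereal (L_fin lam x ?n m - \<mu> * ln (W (1 / 4) m)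
      + (0.5 * \<mu> * (real CARD('m option) - 1) * ln (350 * real CARD('m option)) + 0.01 * \<mu>))"
  proof -
    \<comment> \<open>it remains to see \<open>2 - (d - 1) ln 2 \<le> (d - 1) ln (350 d) / 2\<close>, where \<open>ln (350 d) \<ge> 4\<close> suffices\<close>
    have d: "1 \<le> ?d"
      by (simp add: Suc_le_eq)
    have "exp (4 :: real) \<le> 3 ^ 4"
      using power_mono[OF exp_le, of 4] by (simp flip: exp_of_nat_mult)
    then have "4 \<le> ln (350 * real CARD('m option))"
      using d by (subst ln_ge_iff) (auto simp: card_UNIV_option)
    then have "1 * 4 \<le> ?d * ln (350 * real CARD('m option))"
      using d by (intro mult_mono) auto
    moreover define y where "y = ?d * ln (350 * real CARD('m option))"
    ultimately have "4 \<le> y"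
      by simp
    define b where "b = ?d * (ln (1 / 2) - ln (1 / 4 :: real))"
    have "0 \<le> b"
      unfolding b_def by (intro mult_nonneg_nonneg) auto
    with \<open>4 \<le> y\<close> have "\<mu> * (2 - b) \<le> \<mu> * (0.5 * y + 0.01)"
      using \<mu>(2) by (intro mult_left_mono) auto
    moreover have "L_fin lam x ?n w\<^sub>t + \<mu> * V_fin lam x ?n w\<^sub>t \<le> L_fin lam x ?n m + \<mu> * V_fin lam x ?n m"
      by (rule wt(3)[OF m])
    moreover have "ln (W (1 / 2) w\<^sub>t) = ln c + ?d * ln (1 / 2) - V_fin lam x ?n w\<^sub>t"
      by (rule dikin_W(3)[OF wt(1,2)]) simp
    moreover have "ln (W (1 / 4) m) = ln c + ?d * ln (1 / 4) - V_fin lam x ?n m"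
      by (rule dikin_W(3)[OF m]) simp
    ultimately show ?thesis
      by (simp only: b_def y_def) (simp add: algebra_simps card_UNIV_option)
  qed
  also have "\<dots> \<le> Fbar_obj lam \<mu> x ?n phibar
      + ereal (0.5 * \<mu> * (real CARD('m option) - 1) * ln (350 * real CARD('m option)) + 0.01 * \<mu>)"
    using Fbar_obj_ge[OF adm lam(1) less_imp_le[OF \<mu>(2)], of phibar] feas(2) m
      dikin_W(1,2)[OF m, of "1 / 4"]
    unfolding plus_ereal.simps(1)[symmetric] m_def[symmetric] by (intro add_right_mono) auto
  finally show ?thesis .
qed

end
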